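(* Let $\Omega\subset\mathbb{R}^2$ be a bounded domain with Lipschitz boundary, let $1<q<2$, and let $h\colon\mathbb{R}\to[0,+\infty]$ be such that: $h$ is convex and $C^1$ on $(0,+\infty)$; $\lim_{t\to0+}h(t)=+\infty$ and $\liminf_{t\to\infty}h(t)/t>0$; and $h(t)=+\infty$ for $t\le 0$. Let $W\colon\mathbb{R}^{2\times2}\to[0,+\infty]$ be given by $W(A):=|A|^q+h(\det A)$ and $I(u):=\int_\Omega W(\nabla u(x))\,dx$. Let $\lambda>0$ be such that $$\frac{1}{2^{3-q}\,h'(\lambda^2)\,\lambda^{2-q}}\ \ge\ (q-1)^{(q-1)/2}q^{-q/2}.$$ Then any $u\in\mathcal{A}_\lambda$ satisfies $I(u)\ge I(u_\lambda)$.
   Context: $|A|=(\operatorname{tr}(A^TA))^{1/2}$. $u_\lambda(x):=\lambda x$. The admissible class is $\mathcal{A}_\lambda:=\{u\in W^{1,q}(\Omega,\mathbb{R}^2): u=u_\lambda \text{ on }\partial\Omega \text{ (in the sense of traces)},\ \det\nabla u>0\text{ a.e. in }\Omega\}$. The displayed condition on $\lambda$ is understood to concern the case $h'(\lambda^2)>0$ (its right-hand side is positive). $I(u)$ may equal $+\infty$. *)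

theory Defs
  imports "HOL-Analysis.Analysis"
begin

type_synonym plane = "real^2"
type_synonym mat2 = "real^2^2"

primrec Ck :: "nat \<Rightarrow> ('a::euclidean_space \<Rightarrow> 'b::real_normed_vector) \<Rightarrow> bool" where
  "Ck 0 f \<longleftrightarrow> continuous_on UNIV f"
| "Ck (Suc k) f \<longleftrightarrow> (\<forall>x. f differentiable (at x)) \<and>
     (\<forall>v. Ck k (\<lambda>x. frechet_derivative f (at x) v))"

definition smooth :: "('a::euclidean_space \<Rightarrow> 'b::real_normed_vector) \<Rightarrow> bool" where
  "smooth f \<longleftrightarrow> (\<forall>k. Ck k f)"

definition test_function :: "plane set \<Rightarrow> (plane \<Rightarrow> real) \<Rightarrow> bool" where
  "test_function \<Omega> \<phi> \<longleftrightarrow> smooth \<phi> \<and> compact (closure {x. \<phi> x \<noteq> 0}) \<and> closure {x. \<phi> x \<noteq> 0} \<subseteq> \<Omega>"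

text \<open>Near every boundary point, after an orthogonal change of coordinates, the set is the
  region strictly above the graph of a Lipschitz function.\<close>

definition lipschitz_boundary :: "plane set \<Rightarrow> bool" where
  "lipschitz_boundary \<Omega> \<longleftrightarrow>
     (\<forall>p\<in>frontier \<Omega>. \<exists>r>0. \<exists>(R :: plane \<Rightarrow> plane) L. \<exists>\<gamma>::real \<Rightarrow> real.
        orthogonal_transformation R \<and> L-lipschitz_on UNIV \<gamma> \<and>
        \<Omega> \<inter> ball p r = {x \<in> ball p r. \<gamma> (R x $ 1) < R x $ 2})"

definition Lq :: "'a measure \<Rightarrow> real \<Rightarrow> ('a \<Rightarrow> 'b::real_normed_vector) \<Rightarrow> bool" where
  "Lq M q f \<longleftrightarrow> f \<in> borel_measurable M \<and> integrable M (\<lambda>x. norm (f x) powr q)"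

definition Lq_tendsto ::
  "'a measure \<Rightarrow> real \<Rightarrow> (nat \<Rightarrow> 'a \<Rightarrow> 'b::real_normed_vector) \<Rightarrow> ('a \<Rightarrow> 'b) \<Rightarrow> bool" where
  "Lq_tendsto M q v f \<longleftrightarrow>
     (\<lambda>k. \<integral>\<^sup>+x. ennreal (norm (v k x - f x) powr q) \<partial>M) \<longlonglongrightarrow> 0"

text \<open>Convention: the entry \<open>G x $ i $ j\<close> is the \<open>j\<close>-th partial derivative of the \<open>i\<close>-th component.\<close>

definition has_weak_gradient :: "plane set \<Rightarrow> (plane \<Rightarrow> plane) \<Rightarrow> (plane \<Rightarrow> mat2) \<Rightarrow> bool" where
  "has_weak_gradient \<Omega> u G \<longleftrightarrow>
     (\<forall>K. compact K \<and> K \<subseteq> \<Omega> \<longrightarrow> set_integrable lebesgue K u \<and> set_integrable lebesgue K G) \<and>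
     (\<forall>\<phi> i j. test_function \<Omega> \<phi> \<longrightarrow>
        (LINT x|lebesgue_on \<Omega>. u x $ i * frechet_derivative \<phi> (at x) (axis j 1)) =
        - (LINT x|lebesgue_on \<Omega>. G x $ i $ j * \<phi> x))"

text \<open>The weak gradient is unique up to null sets of \<open>\<Omega>\<close>; this picks a representative.\<close>

definition weak_gradient :: "plane set \<Rightarrow> (plane \<Rightarrow> plane) \<Rightarrow> plane \<Rightarrow> mat2" where
  "weak_gradient \<Omega> u = (SOME G. has_weak_gradient \<Omega> u G)"

definition sobolev :: "plane set \<Rightarrow> real \<Rightarrow> (plane \<Rightarrow> plane) set" where
  "sobolev \<Omega> q = {u. Lq (lebesgue_on \<Omega>) q u \<and> (\<exists>G. has_weak_gradient \<Omega> u G) \<and>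
     Lq (lebesgue_on \<Omega>) q (weak_gradient \<Omega> u)}"

definition hausdorff1_pre :: "real \<Rightarrow> plane set \<Rightarrow> ennreal" where
  "hausdorff1_pre \<delta> S =
     (INF C \<in> {C :: nat \<Rightarrow> plane set. S \<subseteq> (\<Union>i. C i) \<and> (\<forall>i. bounded (C i) \<and> diameter (C i) \<le> \<delta>)}.
        \<Sum>i. ennreal (diameter (C i)))"

definition hausdorff1_outer :: "plane set \<Rightarrow> ennreal" where
  "hausdorff1_outer S = (SUP \<delta>\<in>{0<..}. hausdorff1_pre \<delta> S)"

text \<open>The outer measure is metric, hence countably additive on Borel sets, so that \<open>measure_of\<close> does
  not collapse to the null measure.\<close>

definition hausdorff1 :: "plane measure" where
  "hausdorff1 = measure_of UNIV (sets borel) hausdorff1_outer"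

abbreviation boundary_measure :: "plane set \<Rightarrow> plane measure" where
  "boundary_measure \<Omega> \<equiv> restrict_space hausdorff1 (frontier \<Omega>)"

text \<open>The trace operator on a bounded Lipschitz domain is the continuous extension to
  \<open>W\<^sup>1\<^sup>,\<^sup>q(\<Omega>)\<close> of the restriction map \<open>v \<mapsto> v|\<partial>\<Omega>\<close>, which is bounded from the dense subspace of
  functions smooth up to the boundary into \<open>L\<^sup>q(\<partial>\<Omega>)\<close>. Its graph is the closure of the graph of
  the restriction map.\<close>

definition has_trace ::
  "plane set \<Rightarrow> real \<Rightarrow> (plane \<Rightarrow> plane) \<Rightarrow> (plane \<Rightarrow> plane) \<Rightarrow> bool" where
  "has_trace \<Omega> q u g \<longleftrightarrow> Lq (boundary_measure \<Omega>) q g \<and>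
     (\<exists>v :: nat \<Rightarrow> plane \<Rightarrow> plane. (\<forall>k. smooth (v k)) \<and>
        Lq_tendsto (lebesgue_on \<Omega>) q v u \<and>
        Lq_tendsto (lebesgue_on \<Omega>) q
          (\<lambda>k x. matrix (frechet_derivative (v k) (at x))) (weak_gradient \<Omega> u) \<and>
        Lq_tendsto (boundary_measure \<Omega>) q v g)"

definition frob :: "mat2 \<Rightarrow> real" where
  "frob A = sqrt (trace (transpose A ** A))"

definition stored_energy :: "real \<Rightarrow> (real \<Rightarrow> ennreal) \<Rightarrow> mat2 \<Rightarrow> ennreal" where
  "stored_energy q h A = ennreal (frob A powr q) + h (det A)"

definition energy ::
  "plane set \<Rightarrow> real \<Rightarrow> (real \<Rightarrow> ennreal) \<Rightarrow> (plane \<Rightarrow> plane) \<Rightarrow> ennreal" where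
  "energy \<Omega> q h u = (\<integral>\<^sup>+x. stored_energy q h (weak_gradient \<Omega> u x) \<partial>lebesgue_on \<Omega>)"

definition dilation :: "real \<Rightarrow> plane \<Rightarrow> plane" where
  "dilation c x = c *\<^sub>R x"

definition admissible :: "plane set \<Rightarrow> real \<Rightarrow> real \<Rightarrow> (plane \<Rightarrow> plane) set" where
  "admissible \<Omega> q c = {u \<in> sobolev \<Omega> q. has_trace \<Omega> q u (dilation c) \<and>
     (AE x in lebesgue_on \<Omega>. det (weak_gradient \<Omega> u x) > 0)}"

end

theory Submission
  imports Defs "HOL-Computational_Algebra.Polynomial"
begin

text \<open>
  Write \<open>m = h'(c\<^sup>2)\<close>. By convexity of \<open>h\<close>, \<open>W A \<ge> |A|\<^sup>q + h(c\<^sup>2) + m (det A - c\<^sup>2)\<close>. The condition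
  on \<open>c\<close> ensures that on \<open>{det A > 0}\<close> the right-hand side lies above its tangent plane at \<open>c I\<close>,
  which is an affine function of \<open>tr A\<close>. Integrating, the theorem reduces to
  \<open>\<integral>\<^sub>\<Omega> tr \<nabla>u = 2 c |\<Omega>|\<close>; no null Lagrangian property of the determinant, which fails for \<open>q < 2\<close>,
  is used.

  The integral of \<open>\<nabla>u\<close> is controlled by the trace through
  \<open>|\<integral>\<^sub>\<Omega> \<partial>\<^sub>j w| \<le> 2 \<integral>\<^bsub>\<partial>\<Omega>\<^esub> |w| dH\<^sup>1\<close> for \<open>w\<close> of class \<open>C\<^sup>1\<close>. By Fubini, almost every line parallel
  to \<open>e\<^sub>j\<close> meets \<open>\<Omega>\<close> in finitely many intervals with endpoints on \<open>\<partial>\<Omega>\<close>, and the sum of \<open>|w|\<close> over these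
  endpoints, integrated over the lines, is at most \<open>\<integral> |w| dH\<^sup>1\<close> because projections do not
  increase diameters (Eilenberg's inequality). The Lipschitz boundary enters only through
  \<open>H\<^sup>1(\<partial>\<Omega>) < \<infinity>\<close>.
\<close>

subsection \<open>The tangent plane inequality for the stored energy\<close>

text \<open>For \<open>det A > 0\<close> let s be the sum of the singular values of A. Then |A|^2 +
  2 det A = s^2 = (tr A)^2 + (A12 - A21)^2, so tr A <= s, and it suffices to bound the energy below
  by an affine function of s with positive slope. At c I the gradients of |A|^q and of det A are
  both multiples of I, which is why the tangent plane sees A through tr A alone; its slope is q
  2^(q/2-1) c^(q-1) + m c. Scaling A by 1/c leaves the single parameter \<eta> = m c^(2-q), and the
  condition on c is an upper bound for \<eta>. A large \<eta> steepens the plane, while at singular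
  matrices the determinant term vanishes and |A|^q alone has to stay above it. On the boundary, u is
  known only through smooth approximations whose restrictions converge in L^q. The boundary estimate
  is therefore applied to their difference from the dilation, whose boundary integral tends to 0; a
  constant such as 2 in the estimate does no harm.\<close>

lemma powr_above_tangent:
  fixes x y p :: real
  assumes "p \<ge> 1" "x > 0" "y > 0"
  shows "x powr p \<ge> y powr p + p * y powr (p - 1) * (x - y)"
proof -
  have "p * y powr (p - 1) * (x - y) \<le> x powr p - y powr p"
    using assms by (intro convex_on_imp_above_tangent[of "{0<..}"])
      (auto intro!: derivative_eq_intros powr_convex convex_on_subset[OF powr_convex]
        simp: interior_open field_simps)
  then show ?thesis by simp
qed

text \<open>Concave functions on an interval are smallest at an endpoint. Concavity of the power
  \<theta> <= 1 is drawn from convexity of the power 1/\<theta>, applied to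
  \<open>x powr \<theta>\<close> and \<open>y powr \<theta>\<close>.\<close>

lemma powr_plus_linear_ge_min:
  fixes p x y \<theta> m :: real
  assumes "0 < \<theta>" "\<theta> \<le> 1" "0 < x" "x \<le> p" "p \<le> y"
  shows "p powr \<theta> - m * p \<ge> min (x powr \<theta> - m * x) (y powr \<theta> - m * y)"
proof -
  obtain t where t: "0 \<le> t" "t \<le> 1" "p = (1 - t) * x + t * y"
  proof (cases "x = y")
    case True
    then show ?thesis using assms that[of 0] by simp
  next
    case False
    define t where "t = (p - x) / (y - x)"
    have "t * (y - x) = p - x" using False by (simp add: t_def)
    moreover have "0 \<le> t" "t \<le> 1" using assms False by (auto simp: t_def divide_simps)
    ultimately show ?thesis using that[of t] by (simp add: algebra_simps)
  qed
  have xy: "0 < x powr \<theta>" "0 < y powr \<theta>" using assms by auto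
  have "((1 - t) *\<^sub>R x powr \<theta> + t *\<^sub>R y powr \<theta>) powr (1 / \<theta>)
      \<le> (1 - t) * (x powr \<theta>) powr (1 / \<theta>) + t * (y powr \<theta>) powr (1 / \<theta>)"
    using assms t xy by (intro convex_onD[OF powr_convex]) auto
  also have "\<dots> = p" using assms t by (simp add: powr_powr)
  finally have "(((1 - t) * x powr \<theta> + t * y powr \<theta>) powr (1 / \<theta>)) powr \<theta> \<le> p powr \<theta>"
    using assms by (intro powr_mono2) auto
  then have "(1 - t) * x powr \<theta> + t * y powr \<theta> \<le> p powr \<theta>"
    using assms t xy by (simp add: powr_powr)
  moreover have "(1 - t) * min (x powr \<theta> - m * x) (y powr \<theta> - m * y) \<le> (1 - t) * (x powr \<theta> - m * x)"
    "t * min (x powr \<theta> - m * x) (y powr \<theta> - m * y) \<le> t * (y powr \<theta> - m * y)"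
    using t by (auto intro!: mult_left_mono)
  ultimately show ?thesis by (simp add: t(3) algebra_simps)
qed

text \<open>With r = q - 1 this is the numerical fact that turns the bound on \<eta> into X <= 2^r
  for the quantity \<open>X\<close> of \<open>normalised_energy_bound\<close>. After division by 2^r
  it reads 2^(-(r+1)/2) + r^(-r/2)/4 <= 1, and both terms are replaced by linear functions of
  r.\<close>

lemma two_powr_sum_bound:
  fixes r :: real
  assumes "0 < r" "r < 1"
  shows "2 powr ((r - 1) / 2) + 2 powr (r - 2) * r powr (- r / 2) \<le> 2 powr r"
proof -
  \<comment> \<open>Writing r^(-r) = 4^r (1/(4 r))^r moves the equality case of the weighted AM-GM
    inequality from r = 1 to r = 1/4, which tightens the bound for small r.\<close>
  have b: "(1 / (4 * r)) powr r \<le> 5/4 - r"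
  proof -
    have "(1 / (4 * r)) powr r * 1 powr (1 - r) \<le> r * (1 / (4 * r)) + (1 - r) * 1"
      using assms by (intro Youngs_inequality_0) auto
    then show ?thesis using assms by (simp add: field_simps)
  qed
  have two: "2 powr r \<le> 1 + r"
  proof -
    have "2 powr r * 1 powr (1 - r) \<le> r * 2 + (1 - r) * 1"
      using assms by (intro Youngs_inequality_0) auto
    then show ?thesis by simp
  qed
  have s: "(1/2) powr (1/2) \<le> (7072/10000::real)"
      proof -
    have "sqrt (1/2) \<le> (7072/10000::real)"
      by (rule real_le_lsqrt) (simp_all add: power2_eq_square)
    then show ?thesis by (simp add: powr_half_sqrt)
  qed
  \<comment> \<open>A convex function of r lies below its chord between r = 0 and r = 1; the end
    values are 1/sqrt 2 <= 0.7072 and 1/2.\<close>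
  have chord: "2 powr (- (r + 1) / 2) \<le> 7072/10000 * (1 - r) + r / 2"
  proof -
    have "(1/2) powr r * ((1/2) powr (1/2)) powr (1 - r) \<le> r * (1/2) + (1 - r) * ((1/2) powr (1/2::real))"
      using assms by (intro Youngs_inequality_0) auto
    also have "\<dots> \<le> r * (1/2) + (1 - r) * (7072/10000)"
      using assms s by (intro add_mono mult_left_mono) auto
    finally have "(1/2) powr r * ((1/2) powr (1/2)) powr (1 - r) \<le> r / 2 + 7072/10000 * (1 - r)" by argo
    moreover have "(1/2) powr r * ((1/2) powr (1/2)) powr (1 - r) = 2 powr (- (r + 1) / 2)"
      by (simp add: powr_powr powr_divide flip: powr_add powr_minus_divide) (simp add: field_simps)
    ultimately show ?thesis by simp
  qed
  define S where "S = r powr (- r / 2)"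
  have "S^2 = r powr (- r)"
    using assms by (simp add: S_def power2_eq_square flip: powr_add)
  also have "\<dots> = 4 powr r * (1 / (4 * r)) powr r"
    using assms by (simp add: powr_divide powr_mult powr_minus divide_simps)
  also have "\<dots> = (2 powr r)^2 * (1 / (4 * r)) powr r"
  proof -
    have "4 powr r = (2 powr r * 2 powr r :: real)" by (simp flip: powr_mult)
    then show ?thesis by (simp add: power2_eq_square)
  qed
  also have "\<dots> \<le> (1 + r)^2 * (5/4 - r)"
    using two b assms by (intro mult_mono power_mono) auto
  \<comment> \<open>The linear majorant of \<open>S\<close> is fitted to the chord: a quarter of it
    plus the chord is 0.9997 - 0.0072 r, just below 1.\<close>
  also have "\<dots> \<le> (117/100 + 8/10 * r)^2"
  proof -
    have "(117/100 + 8/10 * r)^2 - (1 + r)^2 * (5/4 - r) = 1189/10000 + 372/1000 * r + 139/100 * r^2 + r^3"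
      by (simp add: power2_eq_square power3_eq_cube field_simps)
    also have "\<dots> \<ge> 0" using assms by auto
    finally show ?thesis by simp
  qed
  finally have "S^2 \<le> (117/100 + 8/10 * r)^2" .
  then have S: "S \<le> 117/100 + 8/10 * r"
    by (rule power2_le_imp_le) (use assms in simp)
  have "2 powr ((r - 1) / 2) + 2 powr (r - 2) * S = 2 powr r * (2 powr (- (r + 1) / 2) + S / 4)"
  proof -
    have "2 powr ((r - 1) / 2) = 2 powr r * 2 powr (- (r + 1) / 2)"
      unfolding powr_add[symmetric] by (simp add: field_simps)
    moreover have "2 powr (r - 2) = 2 powr r / 4" by (simp add: powr_diff)
    ultimately show ?thesis by (simp add: distrib_left)
  qed
  also have "\<dots> \<le> 2 powr r * 1"
  proof (rule mult_left_mono)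
    show "2 powr (- (r + 1) / 2) + S / 4 \<le> 1" using chord S assms by argo
  qed simp
  finally show ?thesis by (simp add: S_def)
qed

text \<open>Here \<open>p = |A|\<^sup>2\<close> and \<open>d = det A\<close>. For fixed \<open>s\<^sup>2 = p + 2 d\<close> the left-hand side is concave in
  \<open>p \<in> [s\<^sup>2/2, s\<^sup>2]\<close>, so only the conformal case \<open>p = s\<^sup>2/2\<close> and the singular case \<open>p = s\<^sup>2\<close> matter;
  the bound on \<open>\<eta>\<close> is needed in the latter, via Young's inequality.\<close>

lemma normalised_energy_bound:
  fixes q \<eta> p d :: real
  assumes q: "1 < q" "q < 2" and \<eta>: "0 < \<eta>"
    and cond: "\<eta> \<le> 2 powr (q - 3) * q powr (q / 2) * (q - 1) powr (- (q - 1) / 2)"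
    and p: "0 < p" "0 \<le> d" "2 * d \<le> p" and \<tau>: "\<tau>^2 \<le> p + 2 * d"
  shows "p powr (q / 2) + \<eta> * d \<ge> 2 powr (q / 2) + \<eta> + (q * 2 powr (q / 2 - 1) + \<eta>) * (\<tau> - 2)"
proof -
  define s where "s = sqrt (p + 2 * d)"
  define r where "r = q - 1"
  define a where "a = (2::real) powr (q / 2 - 1)"
  \<comment> \<open>\<open>q * X\<close> is the slope of the tangent plane after scaling to c =
    1.\<close>
  define X where "X = a + \<eta> / q"
  have s: "s > 0" "s^2 = p + 2 * d" "\<tau> \<le> s"
    using p \<tau> by (auto simp: s_def real_le_rsqrt)
  have r: "0 < r" "r < 1" "q = r + 1" using q by (auto simp: r_def)
  have a: "a > 0" by (simp add: a_def)
  have aX: "a \<le> X" using \<eta> q by (simp add: X_def)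
  have X2: "X \<le> 2 powr r"
  proof -
    have "\<eta> / q \<le> 2 powr (q - 3) * q powr (q / 2) * (q - 1) powr (- (q - 1) / 2) / q"
      using cond q by (simp add: divide_right_mono)
    also have "\<dots> = 2 powr (r - 2) * r powr (- r / 2) * q powr (q / 2 - 1)"
      using q by (simp add: r_def powr_diff)
    also have "\<dots> \<le> 2 powr (r - 2) * r powr (- r / 2) * 1"
    proof (intro mult_left_mono)
      have "q powr (q / 2 - 1) \<le> q powr 0" using q by (intro powr_mono) auto
      then show "q powr (q / 2 - 1) \<le> 1" using q by simp
    qed auto
    finally have "X \<le> 2 powr ((r - 1) / 2) + 2 powr (r - 2) * r powr (- r / 2)"
      by (simp add: X_def a_def r_def field_simps)
    with two_powr_sum_bound[OF r(1,2)] show ?thesis by simp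
  qed
  have k: "q * 2 powr (q / 2 - 1) + \<eta> = q * X" using q by (simp add: X_def a_def field_simps)
  have ta: "2 powr (q / 2) = 2 * a" by (simp add: a_def powr_diff)
  have sq: "(s^2) powr (q / 2) = s powr q" using s(1) by (simp add: powr_powr flip: powr_numeral)
  \<comment> \<open>Singular case, d = 0. Young's inequality is the Legendre bound s^q >= q X s - r
    X^(q/r). As X^(1/r) <= 2, the last term is at most 2 r X, and what remains is (1 - r) (X - a) >=
    0.\<close>
  have e1: "s powr q \<ge> 2 * a + \<eta> + q * X * (s - 2)"
  proof -
    have "(s powr q) powr (1 / q) * (X powr (q / r)) powr (r / q) \<le> (1 / q) * s powr q + (r / q) * X powr (q / r)"
      using q r s aX a by (intro Youngs_inequality_0) (auto simp: field_simps)
    then have "s * X \<le> (1 / q) * s powr q + (r / q) * X powr (q / r)"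
      using q r s aX a by (simp add: powr_powr)
    then have "q * X * s \<le> s powr q + r * X powr (q / r)"
      using q by (simp add: field_simps)
    moreover have "X powr (q / r) \<le> 2 * X"
    proof -
      have "X powr (q / r) = X powr (1 / r) * X"
        using r aX a by (simp add: add_divide_distrib powr_add)
      moreover have "X powr (1 / r) \<le> (2 powr r) powr (1 / r)"
        using X2 aX a r by (intro powr_mono2) auto
      ultimately show ?thesis using r aX a by (simp add: powr_powr mult_right_mono)
    qed
    then have "r * X powr (q / r) \<le> r * (2 * X)" using r by (intro mult_left_mono) auto
    moreover have "(1 - r) * a \<le> (1 - r) * X" using r aX by (intro mult_left_mono) auto
    moreover have "\<eta> = q * X - q * a" using q by (simp add: X_def field_simps)
    ultimately show ?thesis by (simp add: r(3) algebra_simps)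
  qed
  \<comment> \<open>Conformal case, d = s^2/4: the tangent of s^q at s = 2 takes care of the power,
    and (s - 2)^2 >= 0 of the determinant.\<close>
  have e2: "(s^2 / 2) powr (q / 2) + \<eta> * s^2 / 4 \<ge> 2 * a + \<eta> + q * X * (s - 2)"
  proof -
    have "s powr q \<ge> 2 powr q + q * 2 powr (q - 1) * (s - 2)"
      using q s by (intro powr_above_tangent) auto
    then have "2 powr (- q / 2) * s powr q \<ge> 2 powr (- q / 2) * (2 powr q + q * 2 powr (q - 1) * (s - 2))"
      by (intro mult_left_mono) auto
    also have "2 powr (- q / 2) * (2 powr q + q * 2 powr (q - 1) * (s - 2)) =
       2 powr (- q / 2) * 2 powr q + q * (2 powr (- q / 2) * 2 powr (q - 1)) * (s - 2)"
      by (simp add: algebra_simps)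
    also have "\<dots> = 2 * a + q * a * (s - 2)"
    proof -
      have "2 powr (- q / 2) * 2 powr q = 2 powr 1 * a" "2 powr (- q / 2) * 2 powr (q - 1) = a"
        unfolding a_def powr_add[symmetric] by (simp_all add: field_simps)
      then show ?thesis by simp
    qed
    finally have 1: "2 powr (- q / 2) * s powr q \<ge> 2 * a + q * a * (s - 2)" .
    have 2: "(s^2 / 2) powr (q / 2) = 2 powr (- q / 2) * s powr q"
      using s(1) sq by (simp add: powr_divide powr_minus field_simps)
    have "(s - 2)^2 \<ge> 0" by simp
    then have "\<eta> * (s^2 / 4) \<ge> \<eta> * (s - 1)"
      using \<eta> by (intro mult_left_mono) (auto simp: power2_eq_square algebra_simps)
    moreover have "q * X = q * a + \<eta>" using q by (simp add: X_def field_simps)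
    ultimately show ?thesis using 1 2 by (simp add: algebra_simps)
  qed
  have "p powr (q / 2) - (\<eta> / 2) * p \<ge> min ((s^2 / 2) powr (q / 2) - (\<eta> / 2) * (s^2 / 2)) ((s^2) powr (q / 2) - (\<eta> / 2) * s^2)"
    using q p s by (intro powr_plus_linear_ge_min) auto
  moreover note sq
  moreover have "\<eta> * d = \<eta> / 2 * (s^2 - p)" using s by simp
  ultimately have "p powr (q / 2) + \<eta> * d \<ge> 2 * a + \<eta> + q * X * (s - 2)"
    using e1 e2 by (simp add: algebra_simps min_def split: if_splits)
  moreover have "q * X * (s - 2) \<ge> q * X * (\<tau> - 2)"
    using q aX a s by (intro mult_left_mono) auto
  ultimately show ?thesis unfolding k ta by linarith
qed


lemma frob_eq: "frob A = sqrt ((A$1$1)^2 + (A$1$2)^2 + (A$2$1)^2 + (A$2$2)^2)"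
proof -
  have "trace (transpose A ** A) = (A$1$1)^2 + (A$1$2)^2 + (A$2$1)^2 + (A$2$2)^2"
    by (simp add: trace_def transpose_def matrix_matrix_mult_def sum_2 power2_eq_square)
  then show ?thesis by (simp add: frob_def)
qed

lemma frob_mat: "c > 0 \<Longrightarrow> frob (mat c) powr q = 2 powr (q / 2) * c powr q"
proof -
  assume c: "c > 0"
  have "frob (mat c) = sqrt 2 * c"
    using c by (simp add: frob_eq mat_def real_sqrt_mult)
  then show ?thesis using c by (simp add: powr_mult powr_powr flip: powr_half_sqrt)
qed

text \<open>Homogeneity: |A|^q has degree q and det A has degree 2, so dividing A by c puts the
  tangent point at I and turns m into \<eta> = m c^(2-q).\<close>

lemma polyconvex_part_bound:
  fixes A :: mat2 and q m c :: real
  assumes q: "1 < q" "q < 2" and m: "0 < m" and c: "0 < c" and A: "det A > 0"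
    and cond: "1 / (2 powr (3 - q) * m * c powr (2 - q)) \<ge> (q - 1) powr ((q - 1) / 2) * q powr (- q / 2)"
  shows "frob A powr q + m * det A \<ge> frob (mat c) powr q + m * c^2
     + c powr (q - 1) * (q * 2 powr (q / 2 - 1) + m * c powr (2 - q)) * (trace A - 2 * c)"
proof -
  define \<eta> where "\<eta> = m * c powr (2 - q)"
  define p where "p = (A$1$1)^2 + (A$1$2)^2 + (A$2$1)^2 + (A$2$2)^2"
  have \<eta>: "\<eta> > 0" using m c by (simp add: \<eta>_def)
  have dA: "det A = A$1$1 * A$2$2 - A$1$2 * A$2$1" by (simp add: det_2)
  have tA: "trace A = A$1$1 + A$2$2" by (simp add: trace_def sum_2)
  have cond': "\<eta> \<le> 2 powr (q - 3) * q powr (q / 2) * (q - 1) powr (- (q - 1) / 2)"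
  proof -
    have "- (q - 1) / 2 = - ((q - 1) / 2)" by argo
    then have e: "2 powr (q - 3) = inverse (2 powr (3 - q))" "q powr (q / 2) = inverse (q powr (- q / 2))"
      "(q - 1) powr (- (q - 1) / 2) = inverse ((q - 1) powr ((q - 1) / 2))"
      by (simp_all only: powr_minus[symmetric]) simp_all
    have pos: "2 powr (3 - q) > 0" "q powr (- q / 2) > 0" "(q - 1) powr ((q - 1) / 2) > 0" using q by auto
    show ?thesis unfolding e
      using cond pos \<eta> unfolding mult.assoc[of _ m] \<eta>_def[symmetric] by (simp add: field_simps)
  qed
  have d2: "2 * det A \<le> p"
  proof -
    have "p - 2 * det A = (A$1$1 - A$2$2)^2 + (A$1$2 + A$2$1)^2"
      by (simp add: p_def dA power2_eq_square algebra_simps)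
    then show ?thesis by (smt (verit) zero_le_power2)
  qed
  have tr: "(trace A)^2 \<le> p + 2 * det A"
  proof -
    have "p + 2 * det A - (trace A)^2 = (A$1$2 - A$2$1)^2"
      by (simp add: p_def dA tA power2_eq_square algebra_simps)
    then show ?thesis by (smt (verit) zero_le_power2)
  qed
  have p: "p > 0" using d2 A by linarith
  have "(p / c^2) powr (q / 2) + \<eta> * (det A / c^2) \<ge>
      2 powr (q / 2) + \<eta> + (q * 2 powr (q / 2 - 1) + \<eta>) * (trace A / c - 2)"
    using c p A d2 tr
    by (intro normalised_energy_bound[OF q \<eta> cond'])
       (auto simp: divide_right_mono power_divide add_divide_distrib[symmetric])
  then have "c powr q * ((p / c^2) powr (q / 2) + \<eta> * (det A / c^2)) \<ge>
      c powr q * (2 powr (q / 2) + \<eta> + (q * 2 powr (q / 2 - 1) + \<eta>) * (trace A / c - 2))"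
    by (intro mult_left_mono) auto
  moreover have "c powr q * (p / c^2) powr (q / 2) = frob A powr q"
  proof -
    have "(c^2) powr (q / 2) = c powr q" using c by (simp add: powr_powr flip: powr_numeral)
    moreover have "frob A powr q = p powr (q / 2)"
      using p by (simp add: frob_eq powr_powr flip: p_def powr_half_sqrt)
    ultimately show ?thesis using c p by (simp add: powr_divide)
  qed
  moreover have ce: "c powr q * \<eta> = m * c^2"
    using c by (simp add: \<eta>_def mult.left_commute flip: powr_add)
  then have "c powr q * (\<eta> * (det A / c^2)) = m * det A"
    using c by (simp add: mult.assoc[symmetric])
  moreover have "c powr q * ((q * 2 powr (q / 2 - 1) + \<eta>) * (trace A / c - 2)) =
     c powr (q - 1) * (q * 2 powr (q / 2 - 1) + \<eta>) * (trace A - 2 * c)"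
    using c by (simp add: powr_diff field_simps)
  ultimately show ?thesis
    using frob_mat[OF c] ce unfolding \<eta>_def[symmetric] by (simp add: algebra_simps)
qed

subsection \<open>One-dimensional Hausdorff measure\<close>

text \<open>Caratheodory's criterion. \<open>S - C\<close> is exhausted by the sets
  \<open>A n\<close>, which keep a positive distance from C; what is missing are the shells
  \<open>R k\<close>. Shells of equal parity are separated from each other, so the even and the odd
  ones have total mass at most \<mu> S each. Hence the series over all shells converges and its
  tails vanish.\<close>

lemma metric_outer_measure_closed:
  fixes \<mu> :: "'a::metric_space set \<Rightarrow> ennreal"
  assumes oms: "outer_measure_space (Pow UNIV) \<mu>"
    and sep: "\<And>A B e. e > 0 \<Longrightarrow> (\<And>x y. x \<in> A \<Longrightarrow> y \<in> B \<Longrightarrow> e \<le> dist x y) \<Longrightarrow> \<mu> A + \<mu> B \<le> \<mu> (A \<union> B)"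
    and "closed C"
  shows "C \<in> lambda_system UNIV (Pow UNIV) \<mu>"
proof -
  have mono: "\<mu> A \<le> \<mu> B" if "A \<subseteq> B" for A B
    using oms that by (auto simp: outer_measure_space_def increasing_def)
  have empty: "\<mu> {} = 0" using oms by (auto simp: outer_measure_space_def positive_def)
  interpret P: sigma_algebra UNIV "Pow (UNIV :: 'a set)" by (rule sigma_algebra_Pow)
  have sub2: "\<mu> (A \<union> B) \<le> \<mu> A + \<mu> B" for A B
  proof -
    have "\<mu> (A \<union> (B - A)) \<le> \<mu> A + \<mu> (B - A)"
      using oms by (intro subadditiveD[OF P.countably_subadditive_subadditive]) (auto simp: outer_measure_space_def)
    also have "\<dots> \<le> \<mu> A + \<mu> B" by (intro add_left_mono mono) auto
    finally show ?thesis by simp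
  qed
  \<comment> \<open>\<open>countably_subadditive\<close> speaks of disjoint families only, hence the
    detour through \<open>disjointed\<close>.\<close>
  have subN: "\<mu> (\<Union>i. A i) \<le> (\<Sum>i. \<mu> (A i))" for A :: "nat \<Rightarrow> 'a set"
  proof -
    have "\<mu> (\<Union>i. A i) = \<mu> (\<Union>i. disjointed A i)" by (simp add: UN_disjointed_eq)
    also have "\<dots> \<le> (\<Sum>i. \<mu> (disjointed A i))"
      using oms disjoint_family_disjointed[of A] by (auto simp: outer_measure_space_def countably_subadditive_def)
    also have "\<dots> \<le> (\<Sum>i. \<mu> (A i))" by (intro suminf_le mono disjointed_subset) auto
    finally show ?thesis .
  qed
  have "\<mu> (S \<inter> C) + \<mu> (S - C) \<le> \<mu> S" for S
  \<comment> \<open>The empty set is set apart because \<open>infdist x {}\<close> is 0 by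
    convention, so the distance would not show that x lies outside it.\<close>
  proof (cases "C = {} \<or> \<mu> S = \<infinity>")
    case True
    then show ?thesis using empty by auto
  next
    case False
    define R where "R k = {x \<in> S. inverse (Suc (Suc k)) \<le> infdist x C \<and> infdist x C < inverse (Suc k)}" for k
    define A where "A n = {x \<in> S. inverse (Suc n) \<le> infdist x C}" for n
    have infd: "infdist x C - infdist y C \<le> dist x y" for x y
      using infdist_triangle[of x C y] by simp
    have shells: "(\<Sum>k<N. \<mu> (R (2 * k + b))) \<le> \<mu> (\<Union>k<N. R (2 * k + b))" for N b
    proof (induction N)
      case 0 then show ?case by (simp add: empty)
    next
      case (Suc N)
      have "\<mu> (\<Union>k<N. R (2 * k + b)) + \<mu> (R (2 * N + b)) \<le> \<mu> ((\<Union>k<N. R (2 * k + b)) \<union> R (2 * N + b))"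
      \<comment> \<open>For N = 0 and b = 0 the separation constant below would contain
        \<open>inverse 0\<close>, which is 0, and would be negative.\<close>
      proof (cases "N = 0")
        case True
        then show ?thesis by (simp add: empty)
      next
        case False
        show ?thesis
        proof (rule sep)
          show "inverse (2 * N + b) - inverse (Suc (2 * N + b)) \<le> dist x y"
            if "x \<in> (\<Union>k<N. R (2 * k + b))" "y \<in> R (2 * N + b)" for x y
          proof -
            from that obtain k where "k < N" and x: "inverse (Suc (Suc (2 * k + b))) \<le> infdist x C"
              by (auto simp: R_def)
            have "inverse (real (2 * N + b)) \<le> inverse (real (Suc (Suc (2 * k + b))))"
              using \<open>k < N\<close> by (intro le_imp_inverse_le) auto
            with x that(2) infd[of x y] show ?thesis by (auto simp: R_def)
          qed
          show "inverse (2 * N + b) - inverse (Suc (2 * N + b)) > 0"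
            using False by (simp add: less_imp_inverse_less)
        qed
      qed
      also have "(\<Union>k<N. R (2 * k + b)) \<union> R (2 * N + b) = (\<Union>k<Suc N. R (2 * k + b))"
        by (auto simp: lessThan_Suc)
      finally show ?case using add_right_mono[OF Suc, of "\<mu> (R (2 * N + b))"]
        unfolding sum.lessThan_Suc by (rule order_trans[rotated])
    qed
    have "(\<Sum>k<N. \<mu> (R k)) \<le> \<mu> S + \<mu> S" for N
    proof -
      have "(\<Sum>k<N. \<mu> (R k)) \<le> (\<Sum>k<2*N. \<mu> (R k))" by (intro sum_mono2) auto
      also have "\<dots> = (\<Sum>k<N. \<mu> (R (2 * k + 0))) + (\<Sum>k<N. \<mu> (R (2 * k + 1)))"
        by (induction N) (auto simp: ac_simps)
      also have "\<dots> \<le> \<mu> S + \<mu> S"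
        by (intro add_mono order_trans[OF shells] mono) (auto simp: R_def)
      finally show ?thesis .
    qed
    then have "(\<Sum>k. \<mu> (R k)) \<le> \<mu> S + \<mu> S"
      by (intro suminf_le_const) auto
    also have "\<mu> S + \<mu> S < \<infinity>" using False by (simp add: less_top[symmetric])
    finally have fin: "(\<Sum>k. \<mu> (R k)) < \<infinity>" .
    define f where "f k = enn2real (\<mu> (R k))" for k
    have f: "\<mu> (R k) = ennreal (f k)" for k
      using ennreal_suminf_lessD[OF fin[simplified], of k] by (simp add: f_def)
    have f0: "f k \<ge> 0" for k by (simp add: f_def)
    have summ: "summable f"
      by (rule summable_suminf_not_top) (use fin f0 in \<open>auto simp: f\<close>)
    show ?thesis
    proof (rule ennreal_le_epsilon)
      fix e :: real assume "e > 0"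
      obtain N where N: "norm (\<Sum>i. f (i + N)) < e"
        using suminf_exist_split[OF \<open>e > 0\<close> summ] by blast
      have "S - C \<subseteq> A N \<union> (\<Union>i. R (i + N))"
      proof
        fix x assume x: "x \<in> S - C"
        then have pos: "infdist x C > 0"
          using \<open>closed C\<close> False by (simp add: infdist_pos_not_in_closed)
        show "x \<in> A N \<union> (\<Union>i. R (i + N))"
        proof (cases "x \<in> A N")
          case False
          \<comment> \<open>By minimality the distance is below 1/k, so x lies in shell
            \<open>k - 1\<close>; \<open>N < k\<close> makes this shell part of the tail that starts
            at N.\<close>
          define k where "k = (LEAST n. inverse (Suc n) \<le> infdist x C)"
          obtain n where "inverse (Suc n) < infdist x C" using reals_Archimedean[OF pos] by blast
          then have k: "inverse (Suc k) \<le> infdist x C"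
            unfolding k_def by (intro LeastI[of "\<lambda>n. inverse (real (Suc n)) \<le> infdist x C" n]) simp
          have less: "j < k \<Longrightarrow> infdist x C < inverse (Suc j)" for j
            unfolding k_def using not_less_Least not_le by blast
          have "N < k"
          proof (rule ccontr)
            assume "\<not> N < k"
            then have "inverse (real (Suc N)) \<le> inverse (real (Suc k))" by (intro le_imp_inverse_le) auto
            then have "inverse (real (Suc N)) \<le> infdist x C" using k by (rule order_trans)
            with False x show False by (simp add: A_def)
          qed
          then have "x \<in> R ((k - 1 - N) + N)" using k less[of "k - 1"] x by (auto simp: R_def)
          then show ?thesis by blast
        qed simp
      qed
      then have "\<mu> (S - C) \<le> \<mu> (A N) + \<mu> (\<Union>i. R (i + N))"
        by (rule order_trans[OF mono sub2])
      also have "\<mu> (\<Union>i. R (i + N)) \<le> (\<Sum>i. \<mu> (R (i + N)))" by (rule subN)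
      also have "\<dots> = ennreal (\<Sum>i. f (i + N))"
        unfolding f using summ f0 by (intro suminf_ennreal2) (auto simp: summable_iff_shift)
      also have "\<dots> \<le> e" using N by (intro ennreal_leI) auto
      finally have "\<mu> (S - C) \<le> \<mu> (A N) + e" by (simp add: add_left_mono)
      then have "\<mu> (S \<inter> C) + \<mu> (S - C) \<le> \<mu> (S \<inter> C) + \<mu> (A N) + e"
        by (simp add: add.assoc add_left_mono)
      also have "\<mu> (S \<inter> C) + \<mu> (A N) \<le> \<mu> (S \<inter> C \<union> A N)"
      proof (rule sep)
        show "inverse (Suc N) \<le> dist x y" if "x \<in> S \<inter> C" "y \<in> A N" for x y
          using that infd[of y x] by (auto simp: A_def dist_commute)
      qed auto
      also have "\<dots> \<le> \<mu> S" by (rule mono) (auto simp: A_def)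
      finally show "\<mu> (S \<inter> C) + \<mu> (S - C) \<le> \<mu> S + e" by (simp add: add_right_mono)
    qed
  qed
  moreover have "\<mu> S \<le> \<mu> (S \<inter> C) + \<mu> (S - C)" for S
    using sub2[of "S \<inter> C" "S - C"] by (simp add: Int_Diff_Un)
  ultimately show ?thesis
    unfolding P.lambda_system_eq by (auto intro: antisym)
qed

lemma hausdorff1_pre_le:
  assumes "S \<subseteq> (\<Union>i. C i)" "\<And>i. bounded (C i)" "\<And>i. diameter (C i) \<le> \<delta>"
  shows "hausdorff1_pre \<delta> S \<le> (\<Sum>i. ennreal (diameter (C i)))"
  unfolding hausdorff1_pre_def using assms by (intro INF_lower) auto

lemma hausdorff1_pre_lessE:
  assumes "hausdorff1_pre \<delta> S < e"
  obtains C where "S \<subseteq> (\<Union>i. C i)" "\<And>i. bounded (C i)" "\<And>i. diameter (C i) \<le> \<delta>"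
    "(\<Sum>i. ennreal (diameter (C i))) < e"
  using assms unfolding hausdorff1_pre_def INF_less_iff by auto

lemma hausdorff1_pre_mono: "S \<subseteq> T \<Longrightarrow> \<delta>' \<le> \<delta> \<Longrightarrow> hausdorff1_pre \<delta> S \<le> hausdorff1_pre \<delta>' T"
  unfolding hausdorff1_pre_def by (intro INF_superset_mono) (auto intro: order_trans)

lemma hausdorff1_pre_le_outer: "\<delta> > 0 \<Longrightarrow> hausdorff1_pre \<delta> S \<le> hausdorff1_outer S"
  unfolding hausdorff1_outer_def by (intro SUP_upper) auto

text \<open>Covers of the \<open>A n\<close> that are optimal up to e / 2^(n+1) are merged into one
  sequence by \<open>prod_decode\<close>; the errors add up to e.\<close>

lemma hausdorff1_pre_subadditive:
  fixes A :: "nat \<Rightarrow> plane set"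
  shows "hausdorff1_pre \<delta> (\<Union>i. A i) \<le> (\<Sum>i. hausdorff1_pre \<delta> (A i))"
proof (rule ennreal_le_epsilon)
  fix e :: real assume "0 < e" "(\<Sum>n. hausdorff1_pre \<delta> (A n)) < top"
  then have *: "\<And>n. hausdorff1_pre \<delta> (A n) < hausdorff1_pre \<delta> (A n) + e * (1/2)^Suc n"
    by (auto simp add: less_top dest!: ennreal_suminf_lessD)
  have "\<exists>C. A n \<subseteq> (\<Union>i. C i) \<and> (\<forall>i. bounded (C i)) \<and> (\<forall>i. diameter (C i) \<le> \<delta>) \<and>
    (\<Sum>i. ennreal (diameter (C i))) < hausdorff1_pre \<delta> (A n) + e * (1/2)^Suc n" for n
    using hausdorff1_pre_lessE[OF *[of n]] by metis
  then obtain B :: "nat \<Rightarrow> nat \<Rightarrow> plane set" where B: "\<And>n. A n \<subseteq> (\<Union>i. B n i)" "\<And>n i. bounded (B n i)" "\<And>n i. diameter (B n i) \<le> \<delta>"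
    "\<And>n. (\<Sum>i. ennreal (diameter (B n i))) < hausdorff1_pre \<delta> (A n) + e * (1/2)^Suc n"
    by metis
  define C where "C = case_prod B o prod_decode"
  have "(\<Union>i. A i) \<subseteq> (\<Union>i. C i)"
    using B(1) by (auto simp add: C_def subset_eq) (metis prod.case prod_encode_inverse)
  then have "hausdorff1_pre \<delta> (\<Union>i. A i) \<le> (\<Sum>i. ennreal (diameter (C i)))"
    using B by (intro hausdorff1_pre_le) (auto simp: C_def split: prod.split)
  also have "\<dots> = (\<Sum>n. \<Sum>i. ennreal (diameter (B n i)))"
    unfolding C_def comp_def
    using suminf_ennreal_2dimen[of "\<lambda>n. \<Sum>i. ennreal (diameter (B n i))" "\<lambda>(n, i). ennreal (diameter (B n i))"]
    by (simp add: case_prod_beta)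
  also have "\<dots> \<le> (\<Sum>n. hausdorff1_pre \<delta> (A n) + e * (1/2) ^ Suc n)"
    by (intro suminf_le less_imp_le[OF B(4)]) auto
  also have "... = (\<Sum>n. hausdorff1_pre \<delta> (A n)) + (\<Sum>n. ennreal e * ennreal ((1/2) ^ Suc n))"
    using \<open>0 < e\<close> by (subst suminf_add[symmetric])
       (auto simp del: ennreal_suminf_cmult simp add: ennreal_mult[symmetric])
  also have "\<dots> = (\<Sum>n. hausdorff1_pre \<delta> (A n)) + e"
    unfolding ennreal_suminf_cmult
    by (subst suminf_ennreal_eq[OF zero_le_power power_half_series]) auto
  finally show "hausdorff1_pre \<delta> (\<Union>i. A i) \<le> (\<Sum>n. hausdorff1_pre \<delta> (A n)) + e" .
qed

lemma hausdorff1_outer_mono: "S \<subseteq> T \<Longrightarrow> hausdorff1_outer S \<le> hausdorff1_outer T"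
  unfolding hausdorff1_outer_def by (intro SUP_mono') (auto intro: hausdorff1_pre_mono)

lemma hausdorff1_outer_subadditive:
  fixes A :: "nat \<Rightarrow> plane set"
  shows "hausdorff1_outer (\<Union>i. A i) \<le> (\<Sum>i. hausdorff1_outer (A i))"
  unfolding hausdorff1_outer_def[of "\<Union>i. A i"]
  by (intro SUP_least order_trans[OF hausdorff1_pre_subadditive] suminf_le hausdorff1_pre_le_outer) auto

lemma hausdorff1_outer_empty: "hausdorff1_outer {} = 0"
proof -
  have "hausdorff1_pre \<delta> {} \<le> 0" if "\<delta> > 0" for \<delta>
    using hausdorff1_pre_le[of "{}" "\<lambda>_. {}" \<delta>] that by simp
  then show ?thesis unfolding hausdorff1_outer_def by (simp add: SUP_eq_const[where x=0])
qed

lemma outer_measure_space_hausdorff1: "outer_measure_space (Pow UNIV) hausdorff1_outer"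
  by (auto simp: outer_measure_space_def positive_def increasing_def countably_subadditive_def
    hausdorff1_outer_empty hausdorff1_outer_mono hausdorff1_outer_subadditive)

text \<open>A set of diameter below e cannot meet both A and B, so a fine cover of the union falls
  apart into a cover of A and a cover of B.\<close>

lemma hausdorff1_outer_separated:
  assumes e: "e > 0" "\<And>x y. x \<in> A \<Longrightarrow> y \<in> B \<Longrightarrow> e \<le> dist x y"
  shows "hausdorff1_outer A + hausdorff1_outer B \<le> hausdorff1_outer (A \<union> B)"
proof -
  have small: "hausdorff1_pre \<delta> A + hausdorff1_pre \<delta> B \<le> hausdorff1_pre \<delta> (A \<union> B)" if "\<delta> > 0" "\<delta> < e" for \<delta>
    unfolding hausdorff1_pre_def[of \<delta> "A \<union> B"]
  proof (safe intro!: INF_greatest)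
    fix C :: "nat \<Rightarrow> plane set" assume C: "A \<union> B \<subseteq> (\<Union>i. C i)" "\<forall>i. bounded (C i) \<and> diameter (C i) \<le> \<delta>"
    define CA where "CA i = (if C i \<inter> A = {} then {} else C i)" for i
    define CB where "CB i = (if C i \<inter> B = {} then {} else C i)" for i
    have disj: "C i \<inter> A = {} \<or> C i \<inter> B = {}" for i
    proof (rule ccontr)
      assume "\<not> ?thesis"
      then obtain x y where "x \<in> C i" "x \<in> A" "y \<in> C i" "y \<in> B" by blast
      then show False using e(2)[of x y] C(2) diameter_bounded_bound[of "C i" x y] that
        by (smt (verit))
    qed
    have "A \<subseteq> (\<Union>i. CA i)" "B \<subseteq> (\<Union>i. CB i)"
      using C(1) by (fastforce simp: CA_def CB_def)+
    then have "hausdorff1_pre \<delta> A + hausdorff1_pre \<delta> B \<le> (\<Sum>i. ennreal (diameter (CA i))) + (\<Sum>i. ennreal (diameter (CB i)))"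
      using C(2) that by (intro add_mono hausdorff1_pre_le) (auto simp: CA_def CB_def)
    also have "\<dots> = (\<Sum>i. ennreal (diameter (CA i)) + ennreal (diameter (CB i)))"
      by (rule suminf_add) auto
    also have "\<dots> \<le> (\<Sum>i. ennreal (diameter (C i)))"
      using disj by (intro suminf_le) (auto simp: CA_def CB_def)
    finally show "hausdorff1_pre \<delta> A + hausdorff1_pre \<delta> B \<le> (\<Sum>i. ennreal (diameter (C i)))" .
  qed
  \<comment> \<open>Two independent scales let the two suprema be taken one after the other; a
    common smaller scale only increases both terms.\<close>
  have "hausdorff1_pre \<delta>1 A + hausdorff1_pre \<delta>2 B \<le> hausdorff1_outer (A \<union> B)" if "\<delta>1 > 0" "\<delta>2 > 0" for \<delta>1 \<delta>2
  proof -
    define \<delta> where "\<delta> = min (e / 2) (min \<delta>1 \<delta>2)"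
    have "\<delta> > 0" "\<delta> < e" using that e by (auto simp: \<delta>_def)
    have "hausdorff1_pre \<delta>1 A + hausdorff1_pre \<delta>2 B \<le> hausdorff1_pre \<delta> A + hausdorff1_pre \<delta> B"
      by (intro add_mono hausdorff1_pre_mono) (auto simp: \<delta>_def)
    also note small[OF \<open>\<delta> > 0\<close> \<open>\<delta> < e\<close>]
    also note hausdorff1_pre_le_outer[OF \<open>\<delta> > 0\<close>]
    finally show ?thesis .
  qed
  then have "hausdorff1_pre \<delta>1 A + hausdorff1_outer B \<le> hausdorff1_outer (A \<union> B)" if "\<delta>1 > 0" for \<delta>1
    unfolding hausdorff1_outer_def[of B] using that
    by (subst ennreal_SUP_add_right) (auto intro!: SUP_least)
  then show ?thesis
    unfolding hausdorff1_outer_def[of A]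
    by (subst ennreal_SUP_add_left[symmetric]) (auto intro!: SUP_least)
qed

text \<open>The Caratheodory measurable sets form a sigma-algebra that contains the closed sets,
  hence all Borel sets. This makes \<open>emeasure hausdorff1\<close> agree with the outer measure
  on them.\<close>

lemma measure_space_hausdorff1: "measure_space UNIV (sets borel) hausdorff1_outer"
proof -
  interpret P: sigma_algebra UNIV "Pow (UNIV :: plane set)" by (rule sigma_algebra_Pow)
  define L where "L = lambda_system UNIV (Pow UNIV) hausdorff1_outer"
  have L: "measure_space UNIV L hausdorff1_outer"
    unfolding L_def by (rule P.caratheodory_lemma[OF outer_measure_space_hausdorff1])
  then interpret L: sigma_algebra UNIV L by (simp add: measure_space_def)
  have "C \<in> L" if "closed C" for C
    unfolding L_def
    by (rule metric_outer_measure_closed[OF outer_measure_space_hausdorff1 _ that])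
      (rule hausdorff1_outer_separated)
  then have "Collect closed \<subseteq> L" by blast
  then have "sigma_sets UNIV (Collect closed) \<subseteq> L" by (rule L.sigma_sets_subset)
  then have "sets (borel :: plane measure) \<subseteq> L" by (simp add: borel_eq_closed)
  then show ?thesis
    using measure_down[OF L] sets.sigma_algebra_axioms[of "borel :: plane measure"] by simp
qed

lemma sets_hausdorff1 [simp, measurable_cong]: "sets hausdorff1 = sets borel"
  unfolding hausdorff1_def using sets.sets_measure_of_eq[of "borel :: plane measure"] by simp

lemma space_hausdorff1 [simp]: "space hausdorff1 = UNIV"
  unfolding hausdorff1_def using sets.space_measure_of_eq[of "borel :: plane measure"] by simp

lemma emeasure_hausdorff1: "A \<in> sets borel \<Longrightarrow> emeasure hausdorff1 A = hausdorff1_outer A"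
  unfolding hausdorff1_def using measure_space_hausdorff1
  by (intro emeasure_measure_of_sigma) (auto simp: measure_space_def)

section \<open>Counting points on parallel lines\<close>

text \<open>\<open>G\<close> is the liminf of the counting functions of projected covers, and
  Fatou's lemma bounds its integral. It replaces the number of points of E on the line x_i = t, so
  that the measurability of this number in t never comes up.\<close>

lemma eilenberg_projection:
  fixes E :: "plane set" and i :: 2
  obtains G :: "real \<Rightarrow> ennreal" where "G \<in> borel_measurable lborel"
    "\<And>t F. finite F \<Longrightarrow> F \<subseteq> E \<Longrightarrow> (\<And>x. x \<in> F \<Longrightarrow> x$i = t) \<Longrightarrow> of_nat (card F) \<le> G t"
    "(\<integral>\<^sup>+t. G t \<partial>lborel) \<le> hausdorff1_outer E"
proof (cases "hausdorff1_outer E = \<infinity>")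
  case True
  show ?thesis by (rule that[of "\<lambda>_. \<infinity>"]) (auto simp: True)
next
  case False
  define \<epsilon> where "\<epsilon> n = inverse (real (Suc n))" for n
  have \<epsilon>0: "\<epsilon> n > 0" for n by (simp add: \<epsilon>_def)
  have \<epsilon>: "\<epsilon> \<longlonglongrightarrow> 0" unfolding \<epsilon>_def by (rule LIMSEQ_inverse_real_of_nat)
  have "\<exists>C. E \<subseteq> (\<Union>k. C k) \<and> (\<forall>k. bounded (C k)) \<and> (\<forall>k. diameter (C k) \<le> \<epsilon> n) \<and>
      (\<Sum>k. ennreal (diameter (C k))) < hausdorff1_outer E + ennreal (\<epsilon> n)" for n
  proof -
    have "hausdorff1_pre (\<epsilon> n) E \<le> hausdorff1_outer E"
      using \<epsilon>0 by (rule hausdorff1_pre_le_outer)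
    also have "\<dots> < hausdorff1_outer E + ennreal (\<epsilon> n)"
      using False \<epsilon>0[of n] by (simp add: less_top)
    finally show ?thesis by (rule hausdorff1_pre_lessE) blast
  qed
  then obtain C :: "nat \<Rightarrow> nat \<Rightarrow> plane set" where C: "\<And>n. E \<subseteq> (\<Union>k. C n k)" "\<And>n k. bounded (C n k)"
     "\<And>n k. diameter (C n k) \<le> \<epsilon> n"
     "\<And>n. (\<Sum>k. ennreal (diameter (C n k))) < hausdorff1_outer E + ennreal (\<epsilon> n)"
    by metis
  have "\<exists>l u. l \<le> u \<and> u - l \<le> diameter (C n k) \<and> (\<forall>x\<in>C n k. l \<le> x$i \<and> x$i \<le> u)" for n k
  proof (cases "C n k = {}")
    case True
    \<comment> \<open>An empty covering set gets the degenerate interval {0}, which adds nothing to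
      the integral.\<close>
    then show ?thesis by (auto intro!: exI[of _ 0])
  next
    case ne: False
    define P where "P = (\<lambda>x. x$i) ` C n k"
    have P: "P \<noteq> {}" using ne by (simp add: P_def)
    have "bounded P" unfolding P_def using C(2) by (intro bounded_linear_image bounded_linear_vec_nth)
    then have bdd: "bdd_above P" "bdd_below P" by (auto intro: bounded_imp_bdd_above bounded_imp_bdd_below)
    have d: "x - y \<le> diameter (C n k)" if "x \<in> P" "y \<in> P" for x y
    proof -
      from that obtain a b where ab: "a \<in> C n k" "b \<in> C n k" "x = a$i" "y = b$i" by (auto simp: P_def)
      have "x - y \<le> norm (a - b)" using component_le_norm_cart[of "a - b" i] ab by simp
      also have "\<dots> \<le> diameter (C n k)" using diameter_bounded_bound[OF C(2) ab(1,2)] by (simp add: dist_norm)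
      finally show ?thesis .
    qed
    have "Sup P \<le> y + diameter (C n k)" if "y \<in> P" for y
      using P d[OF _ that] by (intro cSup_least) (auto simp: algebra_simps)
    then have "Sup P - diameter (C n k) \<le> Inf P"
      using P by (intro cInf_greatest) (auto simp: algebra_simps)
    moreover have "Inf P \<le> Sup P" using P bdd by (simp add: cInf_le_cSup)
    moreover have "Inf P \<le> x$i \<and> x$i \<le> Sup P" if "x \<in> C n k" for x
      using that bdd by (auto simp: P_def intro!: cInf_lower cSup_upper)
    ultimately show ?thesis by (intro exI[of _ "Inf P"] exI[of _ "Sup P"]) auto
  qed
  then obtain l u where lu: "\<And>n k. l n k \<le> u n k" "\<And>n k. u n k - l n k \<le> diameter (C n k)"
    "\<And>n k x. x \<in> C n k \<Longrightarrow> l n k \<le> x$i \<and> x$i \<le> u n k"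
    by metis
  define g where "g n t = (\<Sum>k. indicator {l n k .. u n k} t :: ennreal)" for n t
  have g[measurable]: "g n \<in> borel_measurable lborel" for n unfolding g_def by measurable
  have gint: "(\<integral>\<^sup>+t. g n t \<partial>lborel) \<le> hausdorff1_outer E + ennreal (\<epsilon> n)" for n
  proof -
    have "(\<integral>\<^sup>+t. g n t \<partial>lborel) = (\<Sum>k. emeasure lborel {l n k .. u n k})"
      unfolding g_def by (subst nn_integral_suminf) auto
    also have "\<dots> \<le> (\<Sum>k. ennreal (diameter (C n k)))"
      using lu by (intro suminf_le) (auto intro: ennreal_leI)
    also note less_imp_le[OF C(4)]
    finally show ?thesis .
  qed
  have gcard: "of_nat (card F) \<le> liminf (\<lambda>n. g n t)" if F: "finite F" "F \<subseteq> E" "\<And>x. x \<in> F \<Longrightarrow> x$i = t" for t F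
  proof (rule Liminf_bounded)
    have "\<forall>\<^sub>F n in sequentially. \<epsilon> n < dist x y" if "x \<noteq> y" for x y :: plane
      using \<epsilon> that by (intro order_tendstoD) auto
    then have "\<forall>\<^sub>F n in sequentially. \<forall>x\<in>F. \<forall>y\<in>F. x \<noteq> y \<longrightarrow> \<epsilon> n < dist x y"
      using F(1) by (intro eventually_ball_finite ballI) auto
    then show "\<forall>\<^sub>F n in sequentially. of_nat (card F) \<le> g n t"
    proof eventually_elim
      case (elim n)
      obtain k where k: "\<And>x. x \<in> F \<Longrightarrow> x \<in> C n (k x)"
        using C(1)[of n] F(2) by (metis UN_E subsetD)
      \<comment> \<open>Covering sets have diameter at most \<open>\<epsilon> n\<close>, which is
        below the mutual distances of the points of F. Distinct points thus lie in distinct covering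
        sets, and each contributes 1 to \<open>g n t\<close>.\<close>
      have inj: "inj_on k F"
      proof (rule inj_onI, rule ccontr)
        fix x y assume xy: "x \<in> F" "y \<in> F" "k x = k y" "x \<noteq> y"
        then have "dist x y \<le> diameter (C n (k x))" using k[of x] k[of y] C(2) by (intro diameter_bounded_bound) auto
        with C(3)[of n "k x"] elim xy show False by fastforce
      qed
      have "of_nat (card F) = (\<Sum>j\<in>k ` F. 1 :: ennreal)" using inj by (simp add: card_image)
      also have "\<dots> = (\<Sum>j\<in>k ` F. indicator {l n j .. u n j} t)"
        using lu(3)[OF k] F(3) by (intro sum.cong) (auto simp: indicator_def)
      also have "\<dots> \<le> g n t" unfolding g_def using F(1) by (intro sum_le_suminf) auto
      finally show ?case .
    qed
  qed
  show ?thesis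
  proof (rule that[of "\<lambda>t. liminf (\<lambda>n. g n t)"])
    have "(\<integral>\<^sup>+t. liminf (\<lambda>n. g n t) \<partial>lborel) \<le> liminf (\<lambda>n. \<integral>\<^sup>+t. g n t \<partial>lborel)"
      by (rule nn_integral_liminf) simp
    also have "\<dots> \<le> liminf (\<lambda>n. hausdorff1_outer E + ennreal (\<epsilon> n))"
      using gint by (intro Liminf_mono) auto
    also have "(\<lambda>n. hausdorff1_outer E + ennreal (\<epsilon> n)) \<longlonglongrightarrow> hausdorff1_outer E + ennreal 0"
      by (intro tendsto_intros tendsto_ennrealI \<epsilon>)
    then have "liminf (\<lambda>n. hausdorff1_outer E + ennreal (\<epsilon> n)) = hausdorff1_outer E"
      by (simp add: lim_imp_Liminf)
    finally show "(\<integral>\<^sup>+t. liminf (\<lambda>n. g n t) \<partial>lborel) \<le> hausdorff1_outer E" .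
  qed (use gcard in auto)
qed

subsection \<open>Integrals of partial derivatives and the boundary\<close>

lemma set_integrable_continuous_bounded:
  fixes f :: "'a::euclidean_space \<Rightarrow> real"
  assumes "continuous_on UNIV f" "bounded S" "S \<in> sets borel"
  shows "set_integrable lborel S f"
proof -
  have "compact (closure S)" using assms(2) by (simp add: compact_closure)
  then have "set_integrable lborel (closure S) f"
    unfolding set_integrable_def using assms(1) continuous_on_subset
    by (intro borel_integrable_compact) blast+
  then show ?thesis by (rule set_integrable_subset) (use assms closure_subset in auto)
qed

text \<open>Up to finitely many points, S consists of gaps between consecutive points of F, and over
  each gap the integral is a difference of two values of f. A point borders at most two gaps, whence
  the factor 2.\<close>

lemma integral_derivative_open_finite_frontier:
  fixes f f' :: "real \<Rightarrow> real"
  assumes der: "\<And>x. (f has_real_derivative f' x) (at x)" and cont: "continuous_on UNIV f'"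
    and "finite F" "open S" "bounded S" "frontier S \<subseteq> F"
  shows "\<bar>LINT x:S|lborel. f' x\<bar> \<le> 2 * (\<Sum>x\<in>F. \<bar>f x\<bar>)"
proof -
  have unbdd: "\<not> bounded {a<..}" "\<not> bounded {..<a}" for a :: real
  proof -
    have "\<exists>x>a. B < \<bar>x\<bar>" "\<exists>x<a. B < \<bar>x\<bar>" for B
      by (rule exI[of _ "\<bar>a\<bar> + \<bar>B\<bar> + 1"], linarith) (rule exI[of _ "- \<bar>a\<bar> - \<bar>B\<bar> - 1"], linarith)
    then show "\<not> bounded {a<..}" "\<not> bounded {..<a}"
      unfolding bounded_real by (meson greaterThan_iff lessThan_iff not_le)+
  qed
  \<comment> \<open>Induction adds the largest point last. The largest point borders only the gap on
    its left, and the spare \<open>\<bar>f (Max F)\<bar>\<close> pays for the gap on its right once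
    a larger point is added.\<close>
  have strong: "\<bar>LINT x:S|lborel. f' x\<bar> \<le> 2 * (\<Sum>x\<in>F. \<bar>f x\<bar>) - (if F = {} then 0 else \<bar>f (Max F)\<bar>)"
    using \<open>finite F\<close> \<open>open S\<close> \<open>bounded S\<close> \<open>frontier S \<subseteq> F\<close>
  proof (induction F arbitrary: S rule: finite_linorder_max_induct)
    case empty
    then have "S = {} \<or> S = UNIV" by (simp add: frontier_eq_empty)
    then have "S = {}" using empty not_bounded_UNIV by auto
    then show ?case by (simp add: set_lebesgue_integral_def)
  next
    case (insert a F)
    have dich: "I \<subseteq> S \<or> I \<inter> S = {}" if "connected I" "I \<inter> insert a F = {}" for I
      using connected_Int_frontier[OF that(1), of S] that(2) insert.prems(3) by blast
    have up: "{a<..} \<inter> S = {}"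
      using dich[of "{a<..}"] insert.hyps(2) bounded_subset[OF insert.prems(2)] unbdd(1)[of a] by force
    have aS: "a \<notin> S"
    proof
      assume "a \<in> S"
      then obtain e where "e > 0" "ball a e \<subseteq> S" using insert.prems(1) openE by blast
      then have "a + e / 2 \<in> S" by (auto simp: subset_iff dist_real_def)
      moreover have "a + e / 2 \<in> {a<..}" using \<open>e > 0\<close> by simp
      ultimately show False using up by blast
    qed
    show ?case
    proof (cases "F = {}")
      case True
      have "{..<a} \<inter> S = {}"
        using dich[of "{..<a}"] True bounded_subset[OF insert.prems(2)] unbdd(2)[of a] by force
      with up aS have "x \<notin> S" for x by (cases x a rule: linorder_cases) auto
      then have "S = {}" by blast
      then show ?thesis by (simp add: set_lebesgue_integral_def True)
    next
      case False
      define b where "b = Max F"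
      have b: "b \<in> F" "\<And>x. x \<in> F \<Longrightarrow> x \<le> b" "b < a"
        using False insert.hyps by (auto simp: b_def)
      \<comment> \<open>Cutting at b can create only the frontier point b, which is already in F,
        and it removes a from the frontier.\<close>
      define S' where "S' = S \<inter> {..<b}"
      have S': "open S'" "bounded S'"
        using insert.prems by (auto simp: S'_def intro: bounded_subset)
      have "frontier S' \<subseteq> frontier S \<union> {b}"
        using frontier_Int_subset[of S "{..<b}"] by (auto simp: S'_def)
      moreover have "a \<notin> frontier S'"
      proof -
        have "closure S' \<subseteq> {..b}" by (intro closure_minimal) (auto simp: S'_def)
        then show ?thesis using b(3) by (auto simp: frontier_def)
      qed
      ultimately have "frontier S' \<subseteq> F" using insert.prems(3) b(1) by auto
      from insert.IH[OF S' this]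
      have IH: "\<bar>LINT x:S'|lborel. f' x\<bar> \<le> 2 * (\<Sum>x\<in>F. \<bar>f x\<bar>) - \<bar>f b\<bar>"
        using False by (simp add: b_def)
      have Max: "Max (insert a F) = a" "a \<notin> F" using insert.hyps by (auto intro!: Max_eqI intro: less_imp_le)
      have gap: "{b<..<a} \<subseteq> S \<or> {b<..<a} \<inter> S = {}"
        using b by (intro dich) fastforce+
      have si: "set_integrable lborel A f'" if "bounded A" "A \<in> sets borel" for A
        using cont that by (rule set_integrable_continuous_bounded)
      have [measurable]: "f' \<in> borel_measurable borel" by (rule borel_measurable_continuous_onI[OF cont])
      have sm: "set_borel_measurable lborel A f'" if [measurable]: "A \<in> sets borel" for A
        unfolding set_borel_measurable_def by measurable
      have "\<bar>(LINT x:S|lborel. f' x) - (LINT x:S'|lborel. f' x)\<bar> \<le> \<bar>f a\<bar> + \<bar>f b\<bar>"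
        using gap
      proof
        assume g: "{b<..<a} \<subseteq> S"
        \<comment> \<open>b may or may not belong to S, so only up to a null set is S the cut part
          together with the closed gap.\<close>
        have "AE x in lborel. x \<in> S \<longleftrightarrow> x \<in> S' \<union> {b..a}"
          using AE_lborel_singleton[of b] AE_lborel_singleton[of a]
        proof eventually_elim
          case (elim x)
          show ?case
          proof (cases "x \<le> a")
            case True
            then show ?thesis using elim g aS by (auto simp: S'_def not_less)
          next
            case False
            then have "x \<notin> S" using up by (auto simp: disjoint_iff)
            then show ?thesis using False b(3) by (auto simp: S'_def)
          qed
        qed
        then have "(LINT x:S|lborel. f' x) = (LINT x:S' \<union> {b..a}|lborel. f' x)"
          using insert.prems(1) S'(1) by (intro set_integral_cong_set sm) auto
        also have "\<dots> = (LINT x:S'|lborel. f' x) + (LINT x:{b..a}|lborel. f' x)"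
          using S' by (intro set_integral_Un si) (auto simp: S'_def)
        also have "(LINT x:{b..a}|lborel. f' x) = f a - f b"
          unfolding set_lebesgue_integral_def
          using b(3) der cont by (intro integral_FTC_Icc) (auto simp: has_real_derivative_iff_has_vector_derivative intro: has_vector_derivative_at_within continuous_on_subset)
        finally show ?thesis by simp
      next
        assume g: "{b<..<a} \<inter> S = {}"
        have "AE x in lborel. x \<in> S \<longleftrightarrow> x \<in> S'"
          using AE_lborel_singleton[of b] AE_lborel_singleton[of a]
        proof eventually_elim
          case (elim x)
          show ?case
          proof (cases "x \<le> a")
            case True
            then have "x \<in> S \<Longrightarrow> \<not> b < x" using elim g by (auto simp: disjoint_iff)
            then show ?thesis using elim by (auto simp: S'_def)
          next
            case False
            then have "x \<notin> S" using up by (auto simp: disjoint_iff)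
            then show ?thesis using False b(3) by (auto simp: S'_def)
          qed
        qed
        then have "(LINT x:S|lborel. f' x) = (LINT x:S'|lborel. f' x)"
          using insert.prems(1) S'(1) by (intro set_integral_cong_set sm) auto
        then show ?thesis by simp
      qed
      with IH Max insert.hyps(1) show ?thesis by (simp add: sum.insert)
    qed
  qed
  show ?thesis using strong by (simp split: if_splits)
qed

text \<open>Coordinates for Fubini: t labels the lines parallel to axis j, and s runs along them.
  The image of the product measure is recognised as Lebesgue measure by its values on boxes.\<close>

lemma lborel_plane_eq_distr:
  fixes i j :: 2
  assumes "i \<noteq> j"
  shows "(lborel :: plane measure) = distr (lborel \<Otimes>\<^sub>M lborel) borel (\<lambda>(t, s). t *\<^sub>R axis i 1 + s *\<^sub>R axis j 1)"
    (is "_ = distr _ _ ?T")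
proof (rule lborel_eqI)
  have [measurable]: "?T \<in> borel_measurable (lborel \<Otimes>\<^sub>M lborel)"
    by (simp add: borel_measurable_continuous_onI case_prod_beta continuous_intros lborel_prod)
  have UN: "UNIV = {i, j}"
  proof -
    have "k = i \<or> k = j" for k using assms exhaust_2[of i] exhaust_2[of j] exhaust_2[of k] by auto
    then show ?thesis by auto
  qed
  fix l u :: plane assume lu: "\<And>b. b \<in> Basis \<Longrightarrow> l \<bullet> b \<le> u \<bullet> b"
  have lu': "l$k \<le> u$k" for k using lu[of "axis k 1"] by (auto simp: Basis_vec_def inner_axis)
  have "?T -` box l u \<inter> space (lborel \<Otimes>\<^sub>M lborel) = {l$i<..<u$i} \<times> {l$j<..<u$j}"
  proof (intro set_eqI)
    fix z :: "real \<times> real"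
    have "?T z \<in> box l u \<longleftrightarrow> (\<forall>k\<in>{i, j}. l$k < ?T z $ k \<and> ?T z $ k < u$k)"
      by (simp add: mem_box_cart flip: UN)
    then show "z \<in> ?T -` box l u \<inter> space (lborel \<Otimes>\<^sub>M lborel) \<longleftrightarrow> z \<in> {l$i<..<u$i} \<times> {l$j<..<u$j}"
      using assms by (cases z) (simp add: space_pair_measure axis_def)
  qed
  then have "emeasure (distr (lborel \<Otimes>\<^sub>M lborel) borel ?T) (box l u) = emeasure (lborel \<Otimes>\<^sub>M lborel) ({l$i<..<u$i} \<times> {l$j<..<u$j})"
    by (subst emeasure_distr) auto
  also have "\<dots> = ennreal ((u$i - l$i) * (u$j - l$j))"
    using lu' by (subst lborel.emeasure_pair_measure_Times) (auto simp: ennreal_mult)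
  also have "(u$i - l$i) * (u$j - l$j) = (\<Prod>k\<in>UNIV. (u - l)$k)"
    unfolding UN using assms by simp
  also have "\<dots> = (\<Prod>b\<in>Basis. (u - l) \<bullet> b)"
    by (simp add: Basis_vec_def inner_axis UNION_singleton_eq_range prod.reindex axis_eq_axis inj_on_def)
  finally show "emeasure (distr (lborel \<Otimes>\<^sub>M lborel) borel ?T) (box l u) = ennreal (\<Prod>b\<in>Basis. (u - l) \<bullet> b)" .
qed auto

text \<open>Eilenberg's inequality counts points, whereas the lines call for the sum of |w| over
  them. The frontier is therefore cut into layers on which |w| varies by at most \<epsilon>, and
  each layer is counted separately. The total error is a multiple of \<epsilon> times the length of
  the frontier.\<close>

lemma integral_partial_le_boundary_integral:
  fixes w D :: "plane \<Rightarrow> real" and j :: 2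
  assumes "open \<Omega>" "bounded \<Omega>" and fin: "hausdorff1_outer (frontier \<Omega>) < \<infinity>"
    and contw: "continuous_on UNIV w" and contD: "continuous_on UNIV D"
    and der: "\<And>x. ((\<lambda>s. w (x + s *\<^sub>R axis j 1)) has_real_derivative D x) (at 0)"
  shows "ennreal \<bar>LINT x:\<Omega>|lborel. D x\<bar> \<le> 2 * (\<integral>\<^sup>+x\<in>frontier \<Omega>. ennreal \<bar>w x\<bar> \<partial>hausdorff1)"
proof -
  obtain i :: 2 where "i \<noteq> j" by (metis exhaust_2 zero_neq_one)
  define T where "T = (\<lambda>(t, s). t *\<^sub>R axis i 1 + s *\<^sub>R axis j 1 :: plane)"
  have contT: "continuous_on UNIV T" unfolding T_def by (auto simp: case_prod_beta intro!: continuous_intros)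
  have T[measurable]: "T \<in> borel_measurable (lborel \<Otimes>\<^sub>M lborel)"
    using contT by (simp add: borel_measurable_continuous_onI lborel_prod)
  have Tt: "continuous_on UNIV (\<lambda>s. T (t, s))" for t unfolding T_def by (auto intro!: continuous_intros)
  have Ti: "T (t, s) $ i = t" "T (t, s) $ j = s" for t s
    using \<open>i \<noteq> j\<close> by (auto simp: T_def axis_def)
  have Teq: "T (t, x$j) = x" if "x$i = t" for x t
  proof -
    have "T (t, x$j) $ k = x$k" for k
    proof -
      have "k = i \<or> k = j" using \<open>i \<noteq> j\<close> exhaust_2[of i] exhaust_2[of j] exhaust_2[of k] by auto
      then show ?thesis using that by (auto simp: Ti)
    qed
    then show ?thesis by (simp add: vec_eq_iff)
  qed
  have [measurable]: "D \<in> borel_measurable borel" "w \<in> borel_measurable borel" "\<Omega> \<in> sets borel" "frontier \<Omega> \<in> sets borel"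
    using contD contw \<open>open \<Omega>\<close> by (auto intro: borel_measurable_continuous_onI)
  define H where "H t = (LINT s:{s. T (t, s) \<in> \<Omega>}|lborel. D (T (t, s)))" for t
  have int: "integrable lborel (\<lambda>x. indicator \<Omega> x *\<^sub>R D x)"
    using set_integrable_continuous_bounded[OF contD \<open>bounded \<Omega>\<close>] by (simp add: set_integrable_def)
  have intT: "integrable (lborel \<Otimes>\<^sub>M lborel) (\<lambda>z. indicator \<Omega> (T z) *\<^sub>R D (T z))"
    using int unfolding lborel_plane_eq_distr[OF \<open>i \<noteq> j\<close>] T_def[symmetric]
    by (subst (asm) integrable_distr_eq) auto
  have Heq: "(LINT x:\<Omega>|lborel. D x) = (LINT t|lborel. H t)" and Hint: "integrable lborel H"
  proof -
    have "(LINT x:\<Omega>|lborel. D x) = (LINT z|(lborel \<Otimes>\<^sub>M lborel). indicator \<Omega> (T z) *\<^sub>R D (T z))"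
      unfolding set_lebesgue_integral_def
      by (subst lborel_plane_eq_distr[OF \<open>i \<noteq> j\<close>], unfold T_def[symmetric], subst integral_distr) auto
    also have "\<dots> = (LINT t|lborel. LINT s|lborel. indicator \<Omega> (T (t, s)) *\<^sub>R D (T (t, s)))"
      by (rule lborel_pair.integral_fst'[OF intT, symmetric])
    also have "\<dots> = (LINT t|lborel. H t)"
      by (simp add: H_def set_lebesgue_integral_def indicator_def)
    finally show "(LINT x:\<Omega>|lborel. D x) = (LINT t|lborel. H t)" .
    have "integrable lborel (\<lambda>t. LINT s|lborel. indicator \<Omega> (T (t, s)) *\<^sub>R D (T (t, s)))"
      by (rule lborel_pair.integrable_fst'[OF intT])
    then show "integrable lborel H"
      by (simp add: H_def[abs_def] set_lebesgue_integral_def indicator_def)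
  qed
  have slice: "\<bar>H t\<bar> \<le> 2 * (\<Sum>x\<in>{x\<in>frontier \<Omega>. x$i = t}. \<bar>w x\<bar>)" if "finite {x\<in>frontier \<Omega>. x$i = t}" for t
  proof -
    define S where "S = {s. T (t, s) \<in> \<Omega>}"
    define F where "F = {s. T (t, s) \<in> frontier \<Omega>}"
    have bij: "bij_betw (\<lambda>s. T (t, s)) F {x\<in>frontier \<Omega>. x$i = t}"
      by (rule bij_betwI[where g = "\<lambda>x. x$j"]) (auto simp: F_def Ti Teq)
    have openS: "open S"
      unfolding S_def using continuous_open_vimage[OF \<open>open \<Omega>\<close>, of "\<lambda>s. T (t, s)"] Tt[of t]
      by (simp add: vimage_def continuous_on_eq_continuous_at)
    have "S \<subseteq> (\<lambda>x. x$j) ` \<Omega>"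
    proof
      fix s assume "s \<in> S"
      then show "s \<in> (\<lambda>x. x$j) ` \<Omega>" using Ti(2)[of t s] by (auto simp: S_def intro!: image_eqI[of s _ "T (t, s)"])
    qed
    moreover have "bounded ((\<lambda>x. x$j) ` \<Omega>)"
      using \<open>bounded \<Omega>\<close> by (intro bounded_linear_image bounded_linear_vec_nth)
    ultimately have "bounded S" by (rule bounded_subset[rotated])
    have "frontier S \<subseteq> F"
    proof
      fix s assume s: "s \<in> frontier S"
      then have "s \<notin> S" using openS by (simp add: frontier_def interior_open)
      have "closure S \<subseteq> {s. T (t, s) \<in> closure \<Omega>}"
      proof (rule closure_minimal)
        show "S \<subseteq> {s. T (t, s) \<in> closure \<Omega>}" using closure_subset by (auto simp: S_def)
        show "closed {s. T (t, s) \<in> closure \<Omega>}"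
          using continuous_closed_vimage[OF closed_closure, of "\<lambda>s. T (t, s)" \<Omega>] Tt[of t]
          by (simp add: vimage_def continuous_on_eq_continuous_at)
      qed
      then have "T (t, s) \<in> closure \<Omega>" using s by (auto simp: frontier_def)
      then show "s \<in> F" using \<open>s \<notin> S\<close> \<open>open \<Omega>\<close> by (simp add: F_def S_def frontier_def interior_open)
    qed
    have "finite F" using bij_betw_finite[OF bij] that by simp
    have "\<bar>H t\<bar> \<le> 2 * (\<Sum>s\<in>F. \<bar>w (T (t, s))\<bar>)"
      unfolding H_def S_def[symmetric]
    proof (rule integral_derivative_open_finite_frontier[OF _ _ \<open>finite F\<close> openS \<open>bounded S\<close> \<open>frontier S \<subseteq> F\<close>])
      show "((\<lambda>s. w (T (t, s))) has_real_derivative D (T (t, s))) (at s)" for s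
      proof -
        have "((\<lambda>r. w (T (t, s) + r *\<^sub>R axis j 1)) has_real_derivative D (T (t, s))) (at 0)" by (rule der)
        then have "((\<lambda>r. w (T (t, r + s))) has_real_derivative D (T (t, s))) (at 0)"
          by (simp add: T_def algebra_simps)
        then show ?thesis using DERIV_shift[of "\<lambda>s. w (T (t, s))" _ 0 s] by simp
      qed
      show "continuous_on UNIV (\<lambda>s. D (T (t, s)))"
        using continuous_on_compose2[OF contD Tt] by auto
    qed
    also have "(\<Sum>s\<in>F. \<bar>w (T (t, s))\<bar>) = (\<Sum>x\<in>{x\<in>frontier \<Omega>. x$i = t}. \<bar>w x\<bar>)"
      by (rule sum.reindex_bij_betw[OF bij])
    finally show ?thesis .
  qed
  have eps: "ennreal \<bar>LINT x:\<Omega>|lborel. D x\<bar> \<le> 2 * ((\<integral>\<^sup>+x\<in>frontier \<Omega>. ennreal \<bar>w x\<bar> \<partial>hausdorff1) + ennreal \<epsilon> * hausdorff1_outer (frontier \<Omega>))"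
    if "\<epsilon> > 0" for \<epsilon>
  proof -
    define lev where "lev x = nat \<lfloor>\<bar>w x\<bar> / \<epsilon>\<rfloor>" for x
    have lev: "lev x * \<epsilon> \<le> \<bar>w x\<bar>" "\<bar>w x\<bar> \<le> (lev x + 1) * \<epsilon>" for x
    proof -
      have "real (lev x) = of_int \<lfloor>\<bar>w x\<bar> / \<epsilon>\<rfloor>" using that by (simp add: lev_def)
      then have "real (lev x) \<le> \<bar>w x\<bar> / \<epsilon>" "\<bar>w x\<bar> / \<epsilon> \<le> real (lev x) + 1" by linarith+
      then show "lev x * \<epsilon> \<le> \<bar>w x\<bar>" "\<bar>w x\<bar> \<le> (lev x + 1) * \<epsilon>" using that by (auto simp: field_simps)
    qed
    have "compact (frontier \<Omega>)" using \<open>bounded \<Omega>\<close> by (rule compact_frontier_bounded)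
    then have "bounded (w ` frontier \<Omega>)"
      using continuous_on_subset[OF contw] by (intro compact_imp_bounded compact_continuous_image) auto
    then obtain B where B: "\<And>x. x \<in> frontier \<Omega> \<Longrightarrow> \<bar>w x\<bar> \<le> B" by (auto simp: bounded_real)
    \<comment> \<open>Compactness of the frontier bounds w there, so the layers with
      \<open>k \<le> K\<close> exhaust it.\<close>
    define K where "K = nat \<lfloor>B / \<epsilon>\<rfloor>"
    have K: "lev x \<le> K" if "x \<in> frontier \<Omega>" for x
      unfolding lev_def K_def using B[OF that] \<open>\<epsilon> > 0\<close> by (intro nat_mono floor_mono divide_right_mono) auto
    define E where "E k = {x \<in> frontier \<Omega>. lev x = k}" for k
    have [measurable]: "E k \<in> sets borel" for k
    proof -
      have "{x \<in> space borel. lev x = k} \<in> sets borel" unfolding lev_def by measurable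
      moreover have "E k = frontier \<Omega> \<inter> {x \<in> space borel. lev x = k}" by (auto simp: E_def)
      ultimately show ?thesis by auto
    qed
    define good where "good k G \<longleftrightarrow> G \<in> borel_measurable lborel
      \<and> (\<forall>t F. finite F \<longrightarrow> F \<subseteq> E k \<longrightarrow> (\<forall>x\<in>F. x$i = t) \<longrightarrow> of_nat (card F) \<le> G t)
      \<and> (\<integral>\<^sup>+t. G t \<partial>lborel) \<le> hausdorff1_outer (E k)" for k and G :: "real \<Rightarrow> ennreal"
    have "\<exists>G. good k G" for k
    proof (rule eilenberg_projection[of "E k" i])
      fix G0 :: "real \<Rightarrow> ennreal"
      assume "G0 \<in> borel_measurable lborel"
        "\<And>t F. finite F \<Longrightarrow> F \<subseteq> E k \<Longrightarrow> (\<And>x. x \<in> F \<Longrightarrow> x$i = t) \<Longrightarrow> of_nat (card F) \<le> G0 t"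
        "(\<integral>\<^sup>+t. G0 t \<partial>lborel) \<le> hausdorff1_outer (E k)"
      then show "\<exists>G. good k G" unfolding good_def by (intro exI[of _ G0]) auto
    qed
    then obtain G where G: "\<And>k. good k (G k)" by metis
    have [measurable]: "\<And>k. G k \<in> borel_measurable lborel" using G by (simp add: good_def)
    have Gcard: "of_nat (card F) \<le> G k t" if "finite F" "F \<subseteq> E k" "\<And>x. x \<in> F \<Longrightarrow> x$i = t" for k t F
    proof -
      have "\<forall>t F. finite F \<longrightarrow> F \<subseteq> E k \<longrightarrow> (\<forall>x\<in>F. x$i = t) \<longrightarrow> of_nat (card F) \<le> G k t"
        using G[of k] unfolding good_def by (elim conjE)
      then show ?thesis using that by simp
    qed
    have Gint: "(\<integral>\<^sup>+t. G k t \<partial>lborel) \<le> hausdorff1_outer (E k)" for k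
      using G[of k] by (simp add: good_def)
    define c where "c k = ennreal ((real k + 1) * \<epsilon>)" for k :: nat
    have "ennreal \<bar>H t\<bar> \<le> 2 * (\<Sum>k\<le>K. c k * G k t)" for t
    \<comment> \<open>An infinite \<open>G k t\<close> makes the right-hand side infinite, since the
      weight \<open>c k\<close> is positive. Otherwise the finite subsets of each layer on the line
      have bounded size, so the layer itself is finite there and \<open>slice\<close>
      applies.\<close>
    proof (cases "\<exists>k\<le>K. G k t = \<infinity>")
      case True
      then obtain k where k: "k \<le> K" "G k t = \<infinity>" by blast
      have "c k > 0" using \<open>\<epsilon> > 0\<close> by (simp add: c_def)
      then have "c k * G k t = \<infinity>" using k by (simp add: ennreal_mult_top)
      moreover have "c k * G k t \<le> (\<Sum>k\<le>K. c k * G k t)" using k by (intro member_le_sum) auto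
      ultimately have "(\<Sum>k\<le>K. c k * G k t) = \<infinity>" by (simp add: top_unique)
      then show ?thesis by (simp only: ennreal_mult_top) simp
    next
      case False
      define L where "L k = {x \<in> E k. x$i = t}" for k
      have finL: "finite (L k)" if kK: "k \<le> K" for k
      proof (rule ccontr)
        assume inf: "infinite (L k)"
        obtain r where r: "G k t = ennreal r" "r \<ge> 0" using False kK by (cases "G k t") auto
        obtain N where N: "r < real N" using reals_Archimedean2 by blast
        obtain F where F: "F \<subseteq> L k" "finite F" "card F = N" using infinite_arbitrarily_large[OF inf] by blast
        have "of_nat (card F) \<le> G k t" using F by (intro Gcard) (auto simp: L_def)
        then have "ennreal (real N) \<le> ennreal r" using F r by (simp add: ennreal_of_nat_eq_real_of_nat)
        then show False using N r by (simp add: ennreal_le_iff)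
      qed
      have UN: "{x\<in>frontier \<Omega>. x$i = t} = (\<Union>k\<le>K. L k)" using K by (auto simp: L_def E_def)
      have "\<bar>H t\<bar> \<le> 2 * (\<Sum>x\<in>{x\<in>frontier \<Omega>. x$i = t}. \<bar>w x\<bar>)"
        by (rule slice) (use finL UN in auto)
      also have "(\<Sum>x\<in>{x\<in>frontier \<Omega>. x$i = t}. \<bar>w x\<bar>) = (\<Sum>k\<le>K. \<Sum>x\<in>L k. \<bar>w x\<bar>)"
        unfolding UN using finL by (intro sum.UNION_disjoint) (auto simp: L_def E_def)
      also have "\<dots> \<le> (\<Sum>k\<le>K. (real k + 1) * \<epsilon> * card (L k))"
      proof (rule sum_mono)
        fix k assume "k \<in> {..K}"
        have "(\<Sum>x\<in>L k. \<bar>w x\<bar>) \<le> (\<Sum>x\<in>L k. (real k + 1) * \<epsilon>)"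
          using lev(2) by (intro sum_mono) (auto simp: L_def E_def add.commute)
        then show "(\<Sum>x\<in>L k. \<bar>w x\<bar>) \<le> (real k + 1) * \<epsilon> * card (L k)" by (simp add: mult.commute)
      qed
      finally have "ennreal \<bar>H t\<bar> \<le> ennreal (2 * (\<Sum>k\<le>K. (real k + 1) * \<epsilon> * card (L k)))"
        by (intro ennreal_leI) simp
      also have "\<dots> = 2 * (\<Sum>k\<le>K. c k * of_nat (card (L k)))"
      proof -
        have "(\<Sum>k\<le>K. c k * of_nat (card (L k))) = (\<Sum>k\<le>K. ennreal ((real k + 1) * \<epsilon> * card (L k)))"
          using \<open>\<epsilon> > 0\<close> by (intro sum.cong) (simp_all add: c_def ennreal_mult ennreal_of_nat_eq_real_of_nat)
        also have "\<dots> = ennreal (\<Sum>k\<le>K. (real k + 1) * \<epsilon> * card (L k))"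
          using \<open>\<epsilon> > 0\<close> by (intro sum_ennreal) simp
        finally show ?thesis
          using \<open>\<epsilon> > 0\<close> by (simp add: ennreal_mult sum_nonneg)
      qed
      also have "\<dots> \<le> 2 * (\<Sum>k\<le>K. c k * G k t)"
        using finL by (intro mult_left_mono sum_mono Gcard) (auto simp: L_def)
      finally show ?thesis .
    qed
    note Hle = this
    have "ennreal \<bar>LINT x:\<Omega>|lborel. D x\<bar> \<le> (\<integral>\<^sup>+t. ennreal \<bar>H t\<bar> \<partial>lborel)"
      unfolding Heq using integral_norm_bound_ennreal[OF Hint] by simp
    also have "\<dots> \<le> (\<integral>\<^sup>+t. 2 * (\<Sum>k\<le>K. c k * G k t) \<partial>lborel)"
      by (intro nn_integral_mono Hle)
    also have "\<dots> = 2 * (\<Sum>k\<le>K. c k * (\<integral>\<^sup>+t. G k t \<partial>lborel))"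
      by (subst nn_integral_cmult, simp, subst nn_integral_sum, simp, subst nn_integral_cmult) auto
    also have "\<dots> \<le> 2 * (\<Sum>k\<le>K. c k * emeasure hausdorff1 (E k))"
      using Gint by (intro mult_left_mono sum_mono) (auto simp: emeasure_hausdorff1)
    also have "(\<Sum>k\<le>K. c k * emeasure hausdorff1 (E k)) = (\<integral>\<^sup>+x. (\<Sum>k\<le>K. c k * indicator (E k) x) \<partial>hausdorff1)"
      by (subst nn_integral_sum) (auto simp: nn_integral_cmult_indicator)
    \<comment> \<open>On layer k the weight (k + 1) \<epsilon> exceeds |w| by at most \<epsilon>,
      and each point of the frontier lies in exactly one layer.\<close>
    also have "\<dots> \<le> (\<integral>\<^sup>+x. ennreal \<bar>w x\<bar> * indicator (frontier \<Omega>) x + ennreal \<epsilon> * indicator (frontier \<Omega>) x \<partial>hausdorff1)"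
    proof (rule nn_integral_mono)
      fix x
      show "(\<Sum>k\<le>K. c k * indicator (E k) x) \<le> ennreal \<bar>w x\<bar> * indicator (frontier \<Omega>) x + ennreal \<epsilon> * indicator (frontier \<Omega>) x"
      proof (cases "x \<in> frontier \<Omega>")
        case True
        have "(\<Sum>k\<le>K. c k * indicator (E k) x) = (\<Sum>k\<in>{..K}. if k = lev x then c k else 0)"
          using True by (intro sum.cong) (auto simp: E_def indicator_def)
        also have "\<dots> = c (lev x)" using K[OF True] by simp
        also have "\<dots> \<le> ennreal (\<bar>w x\<bar> + \<epsilon>)"
          unfolding c_def using lev(1)[of x] by (intro ennreal_leI) (simp add: algebra_simps)
        finally show ?thesis using True \<open>\<epsilon> > 0\<close> by (simp add: ennreal_plus)
      next
        case False
        then show ?thesis by (simp add: E_def)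
      qed
    qed
    also have "\<dots> = (\<integral>\<^sup>+x\<in>frontier \<Omega>. ennreal \<bar>w x\<bar> \<partial>hausdorff1) + ennreal \<epsilon> * hausdorff1_outer (frontier \<Omega>)"
      by (subst nn_integral_add) (auto simp: nn_integral_cmult_indicator emeasure_hausdorff1)
    finally show ?thesis by (simp add: mult_left_mono)
  qed
  let ?b = "\<integral>\<^sup>+x\<in>frontier \<Omega>. ennreal \<bar>w x\<bar> \<partial>hausdorff1"
  let ?m = "hausdorff1_outer (frontier \<Omega>)"
  \<comment> \<open>Here the finite length of the frontier enters: with infinite length the error
    term would not tend to 0.\<close>
  have "((\<lambda>\<epsilon>. 2 * (?b + ?m * ennreal \<epsilon>)) \<longlongrightarrow> 2 * (?b + ?m * ennreal 0)) (at_right 0)"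
    using fin by (intro ennreal_tendsto_cmult tendsto_add tendsto_const tendsto_ennrealI tendsto_ident_at) auto
  then have "ennreal \<bar>LINT x:\<Omega>|lborel. D x\<bar> \<le> 2 * (?b + ?m * ennreal 0)"
    by (rule tendsto_lowerbound) (use eps in \<open>auto simp: eventually_at_filter mult.commute[of ?m]\<close>)
  then show ?thesis by simp
qed

section \<open>Finite length of a Lipschitz boundary\<close>

text \<open>The points of the ball below the graph form an open set missing \<Omega>, hence missing
  its closure. Those above the graph belong to \<Omega>, which is open and contains none of its
  frontier points.\<close>

lemma frontier_subset_graph:
  fixes R :: "plane \<Rightarrow> plane"
  assumes "open \<Omega>" and R: "orthogonal_transformation R" and \<gamma>: "L-lipschitz_on UNIV \<gamma>"
    and eq: "\<Omega> \<inter> ball p r = {x \<in> ball p r. \<gamma> (R x $ 1) < R x $ 2}"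
  shows "frontier \<Omega> \<inter> ball p r \<subseteq> {x \<in> ball p r. R x $ 2 = \<gamma> (R x $ 1)}"
proof
  fix x assume x: "x \<in> frontier \<Omega> \<inter> ball p r"
  then have "x \<notin> \<Omega>" using \<open>open \<Omega>\<close> by (simp add: frontier_def interior_open)
  then have "x \<notin> {x \<in> ball p r. \<gamma> (R x $ 1) < R x $ 2}" unfolding eq[symmetric] by blast
  then have ge: "R x $ 2 \<le> \<gamma> (R x $ 1)" using x by (simp add: not_less)
  have cR: "continuous_on UNIV R"
    using orthogonal_transformation_linear[OF R] by (simp add: linear_continuous_on linear_conv_bounded_linear)
  have c\<gamma>: "continuous_on UNIV \<gamma>" using \<gamma> by (rule lipschitz_on_continuous_on)
  define U where "U = {x \<in> ball p r. R x $ 2 < \<gamma> (R x $ 1)}"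
  have "open {x. R x $ 2 < \<gamma> (R x $ 1)}"
    by (intro open_Collect_less continuous_intros cR continuous_on_compose2[OF c\<gamma>]) auto
  then have "open (ball p r \<inter> {x. R x $ 2 < \<gamma> (R x $ 1)})" by (intro open_Int open_ball)
  moreover have "U = ball p r \<inter> {x. R x $ 2 < \<gamma> (R x $ 1)}" by (auto simp: U_def)
  ultimately have "open U" by simp
  moreover have "U \<inter> \<Omega> = {}"
  proof (rule ccontr)
    assume "U \<inter> \<Omega> \<noteq> {}"
    then obtain z where z: "z \<in> U" "z \<in> \<Omega> \<inter> ball p r" by (auto simp: U_def)
    from z(2) have "\<gamma> (R z $ 1) < R z $ 2" unfolding eq by simp
    with z(1) show False by (simp add: U_def)
  qed
  ultimately have "U \<inter> closure \<Omega> = {}" by (simp add: open_Int_closure_eq_empty)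
  then have "x \<notin> U" using x by (auto simp: frontier_def)
  then show "x \<in> {x \<in> ball p r. R x $ 2 = \<gamma> (R x $ 1)}" using x ge by (auto simp: U_def)
qed

text \<open>On the graph the first rotated coordinate determines the point, and the inverse is (1 +
  L)-Lipschitz. Cutting an interval of length 2 r into N equal pieces gives N covering sets of
  diameter at most (1 + L) 2 r / N, and the sum of these bounds does not depend on N.\<close>

lemma hausdorff1_outer_graph_le:
  fixes R :: "plane \<Rightarrow> plane"
  assumes R: "orthogonal_transformation R" and \<gamma>: "L-lipschitz_on UNIV \<gamma>" and r: "r > 0"
  shows "hausdorff1_outer {x \<in> ball p r. R x $ 2 = \<gamma> (R x $ 1)} \<le> ennreal ((1 + L) * (2 * r))"
proof -
  define S where "S = {x \<in> ball p r. R x $ 2 = \<gamma> (R x $ 1)}"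
  have L: "L \<ge> 0" using \<gamma> by (rule lipschitz_on_nonneg)
  have lin: "linear R" using R by (rule orthogonal_transformation_linear)
  have iso: "norm (R x - R y) = dist x y" for x y
    using R lin by (metis dist_norm linear_diff orthogonal_transformation_norm)
  have dist: "dist x y \<le> (1 + L) * \<bar>R x $ 1 - R y $ 1\<bar>" if "x \<in> S" "y \<in> S" for x y
  proof -
    have "dist x y \<le> \<bar>R x $ 1 - R y $ 1\<bar> + \<bar>R x $ 2 - R y $ 2\<bar>"
      using norm_le_l1_cart[of "R x - R y"] by (simp add: iso sum_2)
    also have "\<bar>R x $ 2 - R y $ 2\<bar> \<le> L * \<bar>R x $ 1 - R y $ 1\<bar>"
      using lipschitz_onD[OF \<gamma>, of "R x $ 1" "R y $ 1"] that by (simp add: S_def dist_real_def)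
    finally show ?thesis by (simp add: algebra_simps)
  qed
  have "hausdorff1_pre \<delta> S \<le> ennreal ((1 + L) * (2 * r))" if "\<delta> > 0" for \<delta>
  proof -
    define C0 where "C0 = (1 + L) * (2 * r)"
    have C0: "C0 > 0" using L r by (simp add: C0_def)
    obtain N :: nat where N: "C0 / \<delta> < real N" using reals_Archimedean2 by blast
    have N0: "N > 0" using N C0 that by (cases N) (auto simp: not_less divide_less_0_iff)
    have N\<delta>: "C0 / N \<le> \<delta>" using N N0 that by (simp add: field_simps)
    define a where "a = R p $ 1 - r"
    define C where "C k = (if k < N then {x \<in> S. a + 2 * r * k / N \<le> R x $ 1 \<and> R x $ 1 \<le> a + 2 * r * (k + 1) / N} else {})" for k :: nat
    have bd: "bounded (C k)" for k
      by (rule bounded_subset[of "ball p r"]) (auto simp: C_def S_def)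
    have diam: "diameter (C k) \<le> (if k < N then C0 / N else 0)" for k
    proof (cases "k < N")
      case True
      have "norm (x - y) \<le> C0 / N" if xy: "x \<in> C k" "y \<in> C k" for x y
      proof -
        have S: "x \<in> S" "y \<in> S" using xy True by (auto simp: C_def)
        have "2 * r * (k + 1) / N = 2 * r * k / N + 2 * r / N" by (simp add: add_divide_distrib algebra_simps)
        then have "\<bar>R x $ 1 - R y $ 1\<bar> \<le> 2 * r / N" using xy True unfolding C_def by auto
        then have "(1 + L) * \<bar>R x $ 1 - R y $ 1\<bar> \<le> (1 + L) * (2 * r / N)" using L by (intro mult_left_mono) auto
        with dist[OF S] show ?thesis by (simp add: C0_def dist_norm)
      qed
      then show ?thesis using True C0 by (auto intro!: diameter_le)
    qed (simp add: C_def)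
    have cover: "S \<subseteq> (\<Union>k. C k)"
    proof
      fix x assume x: "x \<in> S"
      have "\<bar>R x $ 1 - R p $ 1\<bar> \<le> dist x p" using component_le_norm_cart[of "R x - R p" 1] by (simp add: iso)
      also have "\<dots> < r" using x by (simp add: S_def dist_commute)
      finally have rng: "0 < R x $ 1 - a" "R x $ 1 - a < 2 * r" by (auto simp: a_def)
      \<comment> \<open>y is the coordinate measured in pieces, so it lies in [0, N) and its floor
        is the index of a piece containing the point.\<close>
      define y where "y = (R x $ 1 - a) * N / (2 * r)"
      define k where "k = nat \<lfloor>y\<rfloor>"
      have "(R x $ 1 - a) * N < 2 * r * N" using rng(2) N0 by (intro mult_strict_right_mono) auto
      then have y: "0 \<le> y" "y < N" using rng(1) r by (auto simp: y_def divide_less_eq mult.commute)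
      have k: "real k \<le> y" "y \<le> real k + 1" "k < N"
        using y by (auto simp: k_def) linarith+
      have "R x $ 1 = a + 2 * r * y / N" using r N0 by (simp add: y_def)
      moreover have "2 * r * real k / N \<le> 2 * r * y / N" "2 * r * y / N \<le> 2 * r * (real k + 1) / N"
        using k r by (auto intro!: divide_right_mono mult_left_mono)
      ultimately have "x \<in> C k" using x k(3) by (auto simp: C_def add.commute)
      then show "x \<in> (\<Union>k. C k)" by blast
    qed
    have "hausdorff1_pre \<delta> S \<le> (\<Sum>k. ennreal (diameter (C k)))"
    proof (rule hausdorff1_pre_le[OF cover bd])
      show "diameter (C k) \<le> \<delta>" for k using diam[of k] N\<delta> that by (auto split: if_splits)
    qed
    also have "\<dots> = (\<Sum>k<N. ennreal (diameter (C k)))"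
      by (rule suminf_finite) (auto simp: C_def)
    also have "\<dots> \<le> (\<Sum>k<N. ennreal (C0 / N))"
      using diam by (intro sum_mono ennreal_leI) (metis lessThan_iff)
    also have "\<dots> = ennreal C0"
      using N0 C0 by (simp add: ennreal_of_nat_eq_real_of_nat flip: ennreal_mult)
    finally show ?thesis by (simp add: C0_def)
  qed
  then show ?thesis unfolding hausdorff1_outer_def S_def[symmetric] by (auto intro: SUP_least)
qed

lemma hausdorff1_outer_lipschitz_boundary:
  assumes "open \<Omega>" "bounded \<Omega>" "lipschitz_boundary \<Omega>"
  shows "hausdorff1_outer (frontier \<Omega>) < \<infinity>"
proof -
  have "\<exists>r>0. hausdorff1_outer (frontier \<Omega> \<inter> ball p r) < \<infinity>" if "p \<in> frontier \<Omega>" for p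
  proof -
    from assms(3) that obtain r and R :: "plane \<Rightarrow> plane" and L \<gamma> where *: "r > 0" "orthogonal_transformation R" "L-lipschitz_on UNIV \<gamma>"
      "\<Omega> \<inter> ball p r = {x \<in> ball p r. \<gamma> (R x $ 1) < R x $ 2}"
      unfolding lipschitz_boundary_def by meson
    have "hausdorff1_outer (frontier \<Omega> \<inter> ball p r) \<le> ennreal ((1 + L) * (2 * r))"
      using hausdorff1_outer_mono[OF frontier_subset_graph[OF assms(1) *(2,3,4)]]
        hausdorff1_outer_graph_le[OF *(2,3,1), of p] by (rule order_trans)
    then show ?thesis using *(1) by (auto intro!: exI[of _ r] simp: le_less_trans)
  qed
  then obtain r where r: "\<And>p. p \<in> frontier \<Omega> \<Longrightarrow> r p > 0 \<and> hausdorff1_outer (frontier \<Omega> \<inter> ball p (r p)) < \<infinity>"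
    by metis
  have "compact (frontier \<Omega>)" using assms(2) by (rule compact_frontier_bounded)
  then obtain P where P: "P \<subseteq> frontier \<Omega>" "finite P" "frontier \<Omega> \<subseteq> (\<Union>p\<in>P. ball p (r p))"
    by (rule compactE_image[of _ "frontier \<Omega>" "\<lambda>p. ball p (r p)"]) (use r in auto)
  have [measurable]: "frontier \<Omega> \<in> sets borel" by auto
  have "frontier \<Omega> = (\<Union>p\<in>P. frontier \<Omega> \<inter> ball p (r p))" using P(3) by blast
  then have "emeasure hausdorff1 (frontier \<Omega>) = emeasure hausdorff1 (\<Union>p\<in>P. frontier \<Omega> \<inter> ball p (r p))"
    by (rule arg_cong)
  also have "\<dots> \<le> (\<Sum>p\<in>P. emeasure hausdorff1 (frontier \<Omega> \<inter> ball p (r p)))"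
    using P by (intro emeasure_subadditive_finite) auto
  also have "\<dots> < \<infinity>"
    using P r by (auto simp: emeasure_hausdorff1 ennreal_sum_less_top less_top subset_iff)
  finally show ?thesis by (simp add: emeasure_hausdorff1)
qed

subsection \<open>Uniqueness of weak gradients\<close>

text \<open>The classical flat function e^(-1/s), extended by 0, together with the prefactors that
  its derivatives produce: these are polynomials in 1/s.\<close>

definition flat_exp :: "real poly \<Rightarrow> real \<Rightarrow> real" where
  "flat_exp p s = (if s > 0 then poly p (1 / s) * exp (- 1 / s) else 0)"

lemma tendsto_poly_times_exp_minus: "((\<lambda>y. poly p y * exp (- y)) \<longlongrightarrow> (0::real)) at_top"
proof -
  have "((\<lambda>y. \<Sum>i\<le>degree p. coeff p i * (y ^ i / exp y)) \<longlongrightarrow> (\<Sum>i\<le>degree p. coeff p i * 0)) at_top"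
    by (intro tendsto_intros tendsto_power_div_exp_0)
  then show ?thesis
    by (simp add: poly_altdef sum_distrib_right exp_minus divide_inverse mult.assoc)
qed

lemma flat_exp_tendsto_0: "(flat_exp p \<longlongrightarrow> 0) (at 0)"
proof -
  have "((\<lambda>y. poly p y * exp (- y)) \<longlongrightarrow> (0::real)) at_top"
    by (rule tendsto_poly_times_exp_minus)
  then have "((\<lambda>s. poly p (inverse s) * exp (- inverse s)) \<longlongrightarrow> (0::real)) (at_right 0)"
    by (rule filterlim_compose[OF _ filterlim_inverse_at_top_right])
  then have r: "(flat_exp p \<longlongrightarrow> 0) (at_right 0)"
    by (rule Lim_transform_eventually)
       (auto simp: flat_exp_def eventually_at_right_less divide_inverse eventually_at_filter)
  have "((\<lambda>s. 0) \<longlongrightarrow> (0::real)) (at_left 0)" by simp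
  then have "(flat_exp p \<longlongrightarrow> 0) (at_left 0)"
    by (rule Lim_transform_eventually) (auto simp: flat_exp_def eventually_at_filter)
  with r show ?thesis by (simp add: filterlim_split_at)
qed

text \<open>In y = 1/s one has d/ds = - y^2 d/dy, which sends p(y) e^(-y) to y^2 (p - p')(y) e^(-y);
  the polynomial y^2 is \<open>[:0, 0, 1:]\<close>.\<close>

lemma flat_exp_has_derivative:
  "(flat_exp p has_real_derivative flat_exp ((p - pderiv p) * [:0, 0, 1:]) s) (at s)"
proof (cases s "0::real" rule: linorder_cases)
  case less
  have "((\<lambda>_. 0) has_real_derivative 0) (at s)" by simp
  then have "(flat_exp p has_real_derivative 0) (at s)"
    by (rule has_field_derivative_transform_within_open[of _ _ _ "{..<0}"]) (use less in \<open>auto simp: flat_exp_def\<close>)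
  then show ?thesis using less by (simp add: flat_exp_def)
next
  case greater
  have "((\<lambda>s. poly p (1 / s) * exp (- 1 / s)) has_real_derivative
     (poly (pderiv p) (1 / s) * (- 1 / s\<^sup>2)) * exp (- 1 / s) + poly p (1 / s) * (exp (- 1 / s) * (1 / s\<^sup>2))) (at s)"
    using greater by (auto intro!: derivative_eq_intros DERIV_chain2[OF poly_DERIV] simp: power2_eq_square field_simps)
  then have "(flat_exp p has_real_derivative
    (poly (pderiv p) (1 / s) * (- 1 / s\<^sup>2)) * exp (- 1 / s) + poly p (1 / s) * (exp (- 1 / s) * (1 / s\<^sup>2))) (at s)"
    by (rule has_field_derivative_transform_within_open[of _ _ _ "{0<..}"]) (use greater in \<open>auto simp: flat_exp_def\<close>)
  moreover have "(poly (pderiv p) (1 / s) * (- 1 / s\<^sup>2)) * exp (- 1 / s) + poly p (1 / s) * (exp (- 1 / s) * (1 / s\<^sup>2))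
     = flat_exp ((p - pderiv p) * [:0, 0, 1:]) s"
    using greater by (simp add: flat_exp_def algebra_simps power2_eq_square)
  ultimately show ?thesis by simp
next
  case equal
  \<comment> \<open>At 0 the difference quotient divides by h, which multiplies the polynomial in
    1/h by its variable and so stays within the family.\<close>
  have "((\<lambda>h. flat_exp (p * [:0, 1:]) h) \<longlongrightarrow> 0) (at 0)" by (rule flat_exp_tendsto_0)
  then have "((\<lambda>h. (flat_exp p (0 + h) - flat_exp p 0) / h) \<longlongrightarrow> 0) (at 0)"
    by (rule Lim_transform_eventually) (auto simp: flat_exp_def eventually_at_filter)
  then show ?thesis using equal by (simp add: DERIV_def flat_exp_def)
qed

lemma flat_exp_smult: "flat_exp (Polynomial.smult c p) s = c * flat_exp p s"
  by (simp add: flat_exp_def)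

text \<open>The point of this class is that it is closed under directional derivatives, so that its members
  are smooth.\<close>

inductive_set bump_algebra :: "(plane \<Rightarrow> real) set" where
  flat: "(\<lambda>x. flat_exp p (n \<bullet> x + b)) \<in> bump_algebra"
| add: "f \<in> bump_algebra \<Longrightarrow> g \<in> bump_algebra \<Longrightarrow> (\<lambda>x. f x + g x) \<in> bump_algebra"
| mult: "f \<in> bump_algebra \<Longrightarrow> g \<in> bump_algebra \<Longrightarrow> (\<lambda>x. f x * g x) \<in> bump_algebra"

lemma bump_algebra_derivative:
  assumes "f \<in> bump_algebra"
  shows "(\<forall>x. f differentiable (at x)) \<and> (\<forall>v. (\<lambda>x. frechet_derivative f (at x) v) \<in> bump_algebra)"
  using assms
proof induction
  case (flat p n b)
  define p' where "p' = (p - pderiv p) * [:0, 0, 1:]"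
  have d: "((\<lambda>x. flat_exp p (n \<bullet> x + b)) has_derivative (\<lambda>v. flat_exp p' (n \<bullet> x + b) * (n \<bullet> v))) (at x)" for x
  proof -
    have "(flat_exp p has_derivative (*) (flat_exp p' (n \<bullet> x + b))) (at (n \<bullet> x + b))"
      using flat_exp_has_derivative[of p "n \<bullet> x + b"] by (simp add: has_field_derivative_def p'_def)
    then show ?thesis
      by (rule has_derivative_compose[rotated]) (auto intro!: derivative_eq_intros)
  qed
  have "(\<lambda>x. frechet_derivative (\<lambda>x. flat_exp p (n \<bullet> x + b)) (at x) v) =
     (\<lambda>x. flat_exp (Polynomial.smult (n \<bullet> v) p') (n \<bullet> x + b))" for v
    using frechet_derivative_at[OF d, symmetric] by (simp add: flat_exp_smult mult.commute)
  then show ?case using d by (auto simp: differentiable_def intro: bump_algebra.flat)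
next
  case (add f g)
  have "((\<lambda>x. f x + g x) has_derivative (\<lambda>v. frechet_derivative f (at x) v + frechet_derivative g (at x) v)) (at x)" for x
    using add.IH frechet_derivative_works by (intro has_derivative_add) blast+
  note d = this
  then have "(\<lambda>x. frechet_derivative (\<lambda>x. f x + g x) (at x) v) =
      (\<lambda>x. frechet_derivative f (at x) v + frechet_derivative g (at x) v)" for v
    using frechet_derivative_at[OF d, symmetric] by simp
  then show ?case using d add.IH by (auto simp: differentiable_def intro!: bump_algebra.add)
next
  case (mult f g)
  have "((\<lambda>x. f x * g x) has_derivative (\<lambda>v. f x * frechet_derivative g (at x) v + frechet_derivative f (at x) v * g x)) (at x)" for x
    using mult.IH frechet_derivative_works by (intro has_derivative_mult) blast+
  note d = this
  then have "(\<lambda>x. frechet_derivative (\<lambda>x. f x * g x) (at x) v) =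
      (\<lambda>x. f x * frechet_derivative g (at x) v + frechet_derivative f (at x) v * g x)" for v
    using frechet_derivative_at[OF d, symmetric] by simp
  then show ?case using d mult by (auto simp: differentiable_def intro!: bump_algebra.add bump_algebra.mult)
qed

lemma bump_algebra_smooth: "f \<in> bump_algebra \<Longrightarrow> smooth f"
proof -
  have "\<forall>f \<in> bump_algebra. Ck k f" for k
    by (induction k) (auto simp: bump_algebra_derivative differentiable_imp_continuous_on differentiable_on_def
      intro!: differentiable_imp_continuous_on)
  then show "f \<in> bump_algebra \<Longrightarrow> smooth f" by (simp add: smooth_def)
qed

text \<open>Each factor is e^(-1/((n+1) d)), where d is the signed distance to one side, and it
  vanishes for d <= 0. The set of nonzero values is the same open box for every n, while growing n
  pushes the values inside it to 1.\<close>

definition box_bump :: "plane \<Rightarrow> plane \<Rightarrow> nat \<Rightarrow> plane \<Rightarrow> real" where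
  "box_bump a b n x = flat_exp 1 (Suc n * (x$1 - a$1)) * flat_exp 1 (Suc n * (b$1 - x$1))
      * (flat_exp 1 (Suc n * (x$2 - a$2)) * flat_exp 1 (Suc n * (b$2 - x$2)))"

lemma smooth_box_bump: "smooth (box_bump a b n)"
proof -
  have 1: "(\<lambda>x::plane. flat_exp 1 (Suc n * (x$i - c))) \<in> bump_algebra" for i c
    using bump_algebra.flat[of 1 "Suc n *\<^sub>R axis i 1" "- Suc n * c"]
    by (simp add: inner_axis' algebra_simps)
  have 2: "(\<lambda>x::plane. flat_exp 1 (Suc n * (c - x$i))) \<in> bump_algebra" for i c
    using bump_algebra.flat[of 1 "- Suc n *\<^sub>R axis i 1" "Suc n * c"]
    by (simp add: inner_axis' algebra_simps)
  show ?thesis unfolding box_bump_def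
    by (intro bump_algebra_smooth bump_algebra.mult 1 2)
qed

lemma mem_box_plane: "x \<in> box a b \<longleftrightarrow> a$1 < x$1 \<and> x$1 < b$1 \<and> a$2 < x$2 \<and> x$2 < b$2" for x :: plane
  by (auto simp: mem_box_cart forall_2)

lemma box_bump_bounds: "0 \<le> box_bump a b n x" "box_bump a b n x \<le> 1"
proof -
  have "0 \<le> flat_exp 1 s" "flat_exp 1 s \<le> 1" for s by (auto simp: flat_exp_def)
  then show "0 \<le> box_bump a b n x" "box_bump a b n x \<le> 1"
    by (auto simp: box_bump_def intro!: mult_nonneg_nonneg mult_le_one)
qed

lemma box_bump_support: "{x. box_bump a b n x \<noteq> 0} = box a b"
  by (auto simp: box_bump_def flat_exp_def mem_box_plane zero_less_mult_iff)

lemma box_bump_tendsto: "(\<lambda>n. box_bump a b n x) \<longlonglongrightarrow> indicator (box a b) x"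
proof -
  have *: "(\<lambda>n. flat_exp 1 (Suc n * s)) \<longlonglongrightarrow> 1" if "s > 0" for s :: real
  proof -
    have "(\<lambda>n. exp (- (inverse (real (Suc n)) * (1 / s)))) \<longlonglongrightarrow> exp (- (0 * (1 / s)))"
      by (intro tendsto_intros LIMSEQ_inverse_real_of_nat)
    then show ?thesis using that by (simp add: flat_exp_def zero_less_mult_iff inverse_eq_divide del: of_nat_Suc)
  qed
  show ?thesis
  proof (cases "x \<in> box a b")
    case True
    have "(\<lambda>n. box_bump a b n x) \<longlonglongrightarrow> 1 * 1 * (1 * 1)"
      unfolding box_bump_def using True by (intro tendsto_mult *) (auto simp: mem_box_plane)
    then show ?thesis using True by simp
  next
    case False
    then have "box_bump a b n x = 0" for n using box_bump_support by blast
    then show ?thesis using False by simp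
  qed
qed

lemma test_function_box_bump: "cbox a b \<subseteq> \<Omega> \<Longrightarrow> test_function \<Omega> (box_bump a b n)"
proof -
  assume "cbox a b \<subseteq> \<Omega>"
  moreover have "closure (box a b) \<subseteq> cbox a b" by (rule closure_minimal[OF box_subset_cbox closed_cbox])
  moreover have "compact (closure (box a b))" using bounded_box by (simp add: compact_closure)
  ultimately show ?thesis unfolding test_function_def box_bump_support
    by (auto intro: smooth_box_bump)
qed

section \<open>The fundamental lemma of the calculus of variations\<close>

text \<open>Boxes are stable under intersection and generate the Borel sets, so vanishing integrals
  extend from boxes to all Borel sets by Dynkin's theorem. The support condition turns the integral
  over the plane into one over a box, as the complement step requires.\<close>

lemma AE_zero_if_box_integrals_zero:
  fixes f :: "plane \<Rightarrow> real"
  assumes f: "integrable lebesgue f" and supp: "\<And>x. x \<notin> box c d \<Longrightarrow> f x = 0"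
    and zero: "\<And>a b. (LINT x|lebesgue. indicator (box a b) x * f x) = 0"
  shows "AE x in lebesgue. f x = 0"
proof -
  \<comment> \<open>The set induction and the density argument live on \<open>lborel\<close>, while
    f is only Lebesgue measurable; a Borel version takes its place.\<close>
  obtain g where g[measurable]: "g \<in> borel_measurable lborel" and fg: "AE x in lborel. f x = g x"
    using completion_ex_borel_measurable_real[of f lborel] f by auto
  have fg': "AE x in lebesgue. f x = g x" using fg by (rule AE_completion)
  have gint: "integrable lborel g"
  proof -
    have "integrable lebesgue g" using f measurable_completion[OF g] fg' by (subst integrable_cong_AE[where g=f]) auto
    then show ?thesis by (simp add: integrable_completion)
  qed
  have eq: "(LINT x:A|lborel. g x) = (LINT x|lebesgue. indicator A x * f x)" if [measurable]: "A \<in> sets borel" for A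
  proof -
    have "(LINT x:A|lborel. g x) = (LINT x|lebesgue. indicator A x * g x)"
      unfolding set_lebesgue_integral_def by (subst integral_completion) auto
    also have "\<dots> = (LINT x|lebesgue. indicator A x * f x)"
      using f fg' measurable_completion[OF g] that
      by (intro integral_cong_AE borel_measurable_times borel_measurable_indicator) auto
    finally show ?thesis .
  qed
  have U: "(LINT x:UNIV|lborel. g x) = 0"
  proof -
    have "(LINT x|lebesgue. indicator UNIV x * f x) = (LINT x|lebesgue. indicator (box c d) x * f x)"
      using supp by (intro Bochner_Integration.integral_cong) (auto simp: indicator_def)
    then show ?thesis unfolding zero using eq[of UNIV] by simp
  qed
  have sub: "set_integrable lborel A g" if "A \<in> sets borel" for A
    by (rule set_integrable_subset[of _ UNIV]) (use gint that in \<open>auto simp: set_integrable_def\<close>)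
  have all: "(LINT x:A|lborel. g x) = 0" if "A \<in> sets borel" for A
  proof -
    have "Int_stable (range (\<lambda>(a::plane, b). box a b))"
      by (auto simp: Int_stable_def box_Int_box)
    moreover have "(range (\<lambda>(a::plane, b). box a b)) \<subseteq> Pow UNIV" by auto
    moreover have "A \<in> sigma_sets UNIV (range (\<lambda>(a, b). box a b))"
      using that by (simp add: borel_eq_box)
    ultimately show ?thesis
    proof (induction rule: sigma_sets_induct_disjoint)
      case (basic A)
      then show ?case using zero by (auto simp: eq)
    next
      case empty
      then show ?case by (simp add: set_lebesgue_integral_def)
    next
      case (compl A)
      then have [measurable]: "A \<in> sets borel" by (simp add: borel_eq_box)
      have "(LINT x:A \<union> (UNIV - A)|lborel. g x) = (LINT x:A|lborel. g x) + (LINT x:UNIV - A|lborel. g x)"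
        by (intro set_integral_Un sub) auto
      with compl U show ?case by simp
    next
      case (union A)
      then have [measurable]: "A i \<in> sets borel" for i by (auto simp: borel_eq_box)
      have "set_integrable lborel (\<Union>i. A i) g"
        by (intro sub) auto
      then have "(LINT x:(\<Union>i. A i)|lborel. g x) = (\<Sum>i. LINT x:A i|lborel. g x)"
        using union(1) by (intro lebesgue_integral_countable_add) (auto simp: disjoint_family_on_def)
      then show ?case using union by simp
    qed
  qed
  have "AE x in lborel. g x = 0"
    by (rule density_unique_real) (use gint all in \<open>auto simp: set_lebesgue_integral_def[of _ _ "\<lambda>_. 0"]\<close>)
  then have "AE x in lebesgue. g x = 0" by (rule AE_completion)
  with fg' show ?thesis by eventually_elim simp
qed

text \<open>Box bumps tend to the indicator of their box, so dominated convergence passes from test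
  functions to boxes whose closed box lies in \<Omega>. By Lindelof's theorem countably many such
  boxes fill \<Omega>.\<close>

lemma AE_zero_if_test_integrals_zero:
  fixes F :: "plane \<Rightarrow> real"
  assumes "open \<Omega>" and loc: "\<And>K. compact K \<Longrightarrow> K \<subseteq> \<Omega> \<Longrightarrow> set_integrable lebesgue K F"
    and zero: "\<And>\<phi>. test_function \<Omega> \<phi> \<Longrightarrow> (LINT x|lebesgue_on \<Omega>. F x * \<phi> x) = 0"
  shows "AE x in lebesgue. x \<in> \<Omega> \<longrightarrow> F x = 0"
proof -
  have \<Omega>: "\<Omega> \<in> sets lebesgue" using \<open>open \<Omega>\<close> by auto
  have box0: "(LINT x|lebesgue. indicator (box a b) x * F x) = 0" if ab: "cbox a b \<subseteq> \<Omega>" for a b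
  proof -
    have int: "integrable lebesgue (\<lambda>x. indicator (cbox a b) x * F x)"
      using loc[OF compact_cbox ab] by (simp add: set_integrable_def)
    have bm: "box_bump a b n \<in> borel_measurable lebesgue" for n
    proof -
      have "continuous_on UNIV (box_bump a b n)"
        using smooth_box_bump[of a b n] by (auto simp: smooth_def dest!: spec[of _ 0])
      then have "box_bump a b n \<in> borel_measurable lborel"
        using borel_measurable_continuous_onI by simp
      then show ?thesis by (rule measurable_completion)
    qed
    have "(\<lambda>n. LINT x|lebesgue. box_bump a b n x * (indicator (cbox a b) x * F x)) \<longlonglongrightarrow>
       (LINT x|lebesgue. indicator (box a b) x * (indicator (cbox a b) x * F x))"
    proof (rule integral_dominated_convergence)
      show "integrable lebesgue (\<lambda>x. norm (indicator (cbox a b) x * F x))" using int by (rule integrable_norm)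
      show "AE x in lebesgue. (\<lambda>n. box_bump a b n x * (indicator (cbox a b) x * F x))
           \<longlonglongrightarrow> indicator (box a b) x * (indicator (cbox a b) x * F x)"
        by (intro AE_I2 tendsto_mult box_bump_tendsto tendsto_const)
      show "AE x in lebesgue. norm (box_bump a b n x * (indicator (cbox a b) x * F x)) \<le> norm (indicator (cbox a b) x * F x)" for n
      proof (intro AE_I2)
        fix x
        have "\<bar>box_bump a b n x\<bar> \<le> 1" using box_bump_bounds[of a b n x] by simp
        then show "norm (box_bump a b n x * (indicator (cbox a b) x * F x)) \<le> norm (indicator (cbox a b) x * F x)"
          unfolding norm_mult by (intro mult_left_le_one_le) auto
      qed
    next
      have "(\<lambda>x. indicator (cbox a b) x * F x) \<in> borel_measurable lebesgue" using int by simp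
      then show "(\<lambda>x. box_bump a b n x * (indicator (cbox a b) x * F x)) \<in> borel_measurable lebesgue"
         "(\<lambda>x. indicator (box a b) x * (indicator (cbox a b) x * F x)) \<in> borel_measurable lebesgue" for n
        using borel_measurable_times[OF bm[of n]] borel_measurable_times[OF borel_measurable_indicator[of "box a b" lebesgue]] by auto
    qed
    moreover have "(LINT x|lebesgue. box_bump a b n x * (indicator (cbox a b) x * F x)) = 0" for n
    proof -
      have "0 = (LINT x|lebesgue_on \<Omega>. F x * box_bump a b n x)"
        using zero[OF test_function_box_bump[OF ab]] by simp
      also have "\<dots> = (LINT x|lebesgue. indicator \<Omega> x *\<^sub>R (F x * box_bump a b n x))"
        using \<Omega> by (intro integral_restrict_space) auto
      also have "(\<lambda>x. indicator \<Omega> x *\<^sub>R (F x * box_bump a b n x)) = (\<lambda>x. box_bump a b n x * (indicator (cbox a b) x * F x))"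
      proof
        fix x
        show "indicator \<Omega> x *\<^sub>R (F x * box_bump a b n x) = box_bump a b n x * (indicator (cbox a b) x * F x)"
        proof (cases "box_bump a b n x = 0")
          case False
          then have "x \<in> box a b" using box_bump_support[of a b n] by blast
          then have "x \<in> cbox a b" using box_subset_cbox by blast
          then show ?thesis using ab by auto
        qed simp
      qed
      finally show ?thesis by simp
    qed
    moreover have "(\<lambda>x. indicator (box a b) x * (indicator (cbox a b) x * F x)) = (\<lambda>x. indicator (box a b) x * F x)"
      using box_subset_cbox[of a b] by (auto simp: indicator_def fun_eq_iff)
    ultimately have "(\<lambda>n::nat. 0) \<longlonglongrightarrow> (LINT x|lebesgue. indicator (box a b) x * F x)" by (simp only:)
    then show ?thesis using LIMSEQ_unique[OF _ tendsto_const] by blast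
  qed
  have AEbox: "AE x in lebesgue. x \<in> box c d \<longrightarrow> F x = 0" if cd: "cbox c d \<subseteq> \<Omega>" for c d
  proof -
    have int: "integrable lebesgue (\<lambda>x. indicator (box c d) x * F x)"
      using set_integrable_subset[OF loc[OF compact_cbox cd], of "box c d"] box_subset_cbox by (auto simp: set_integrable_def)
    have "AE x in lebesgue. indicator (box c d) x * F x = 0"
    proof (rule AE_zero_if_box_integrals_zero[OF int, where c=c and d=d])
      fix a b
      obtain a' b' where ab': "box a b \<inter> box c d = box a' b'" by (rule that[OF box_Int_box])
      show "(LINT x|lebesgue. indicator (box a b) x * (indicator (box c d) x * F x)) = 0"
      \<comment> \<open>An empty open box may come with a nonempty degenerate
        \<open>cbox a' b'\<close> that leaves \<Omega>, so this case is treated apart.\<close>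
      proof (cases "box a' b' = {}")
        case True
        then have "(\<lambda>x. indicator (box a b) x * (indicator (box c d) x * F x)) = (\<lambda>_. 0)"
          using ab' by (auto simp: indicator_def fun_eq_iff)
        then show ?thesis by simp
      next
        case False
        have "cbox a' b' = closure (box a' b')" using closure_box[OF False] by simp
        also have "\<dots> \<subseteq> cbox c d" using ab' box_subset_cbox[of c d] by (intro closure_minimal closed_cbox) auto
        finally have "cbox a' b' \<subseteq> \<Omega>" using cd by blast
        moreover have "(\<lambda>x. indicator (box a b) x * (indicator (box c d) x * F x)) = (\<lambda>x. indicator (box a' b') x * F x)"
          unfolding ab'[symmetric] by (auto simp: indicator_def fun_eq_iff)
        ultimately show ?thesis using box0 by simp
      qed
    qed auto
    then show ?thesis by eventually_elim (auto simp: indicator_def split: if_splits)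
  qed
  obtain \<D> where D: "countable \<D>" "\<And>X. X \<in> \<D> \<Longrightarrow> \<exists>a b. X = box a b \<and> cbox a b \<subseteq> \<Omega>" "\<Union>\<D> = \<Omega>"
  proof -
    define \<F> where "\<F> = {box a b | a b. cbox a b \<subseteq> \<Omega>}"
    obtain \<D> where D: "\<D> \<subseteq> \<F>" "countable \<D>" "\<Union>\<D> = \<Union>\<F>"
      using Lindelof[of \<F>] by (auto simp: \<F>_def)
    have "\<Omega> \<subseteq> \<Union>\<F>"
    proof
      fix x assume "x \<in> \<Omega>"
      then show "x \<in> \<Union>\<F>" by (rule open_contains_cbox[OF \<open>open \<Omega>\<close>]) (auto simp: \<F>_def)
    qed
    then have "\<Union>\<F> = \<Omega>" using box_subset_cbox by (fastforce simp: \<F>_def)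
    with D show ?thesis by (intro that[of \<D>]) (auto simp: \<F>_def)
  qed
  have "AE x in lebesgue. \<forall>X\<in>\<D>. x \<in> X \<longrightarrow> F x = 0"
    using D AEbox by (subst AE_ball_countable) blast+
  then show ?thesis by eventually_elim (use D(3) in blast)
qed

subsection \<open>The mean of the gradient of an admissible map\<close>

text \<open>The pointwise bound y <= e + e^(1-q) y^q with fixed e controls the limsup of the L^1
  norms by e times the total mass; then e tends to 0.\<close>

lemma nn_integral_tendsto_0_if_powr:
  fixes g :: "nat \<Rightarrow> 'a \<Rightarrow> real"
  assumes fin: "emeasure M (space M) < \<infinity>" and q: "q > 1"
    and [measurable]: "\<And>k. g k \<in> borel_measurable M" and nn: "\<And>k x. g k x \<ge> 0"
    and lim: "(\<lambda>k. \<integral>\<^sup>+x. ennreal (g k x powr q) \<partial>M) \<longlonglongrightarrow> 0"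
  shows "(\<lambda>k. \<integral>\<^sup>+x. ennreal (g k x) \<partial>M) \<longlonglongrightarrow> 0"
proof -
  have young: "y \<le> e + e powr (1 - q) * y powr q" if "e > 0" "y \<ge> 0" for e y :: real
  proof (cases "y \<le> e")
    case True
    have "0 \<le> e powr (1 - q) * y powr q" by simp
    with True show ?thesis by linarith
  next
    case False
    have "y powr (1 - q) \<le> e powr (1 - q)"
      using False that q by (intro powr_mono2') auto
    then have "y powr (1 - q) * y powr q \<le> e powr (1 - q) * y powr q" by (intro mult_right_mono) auto
    moreover have "y powr (1 - q) * y powr q = y" using False that by (simp flip: powr_add)
    ultimately show ?thesis using that by linarith
  qed
  have le: "limsup (\<lambda>k. \<integral>\<^sup>+x. ennreal (g k x) \<partial>M) \<le> emeasure M (space M) * ennreal e" if "e > 0" for e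
  proof -
    have "(\<integral>\<^sup>+x. ennreal (g k x) \<partial>M) \<le> emeasure M (space M) * ennreal e + ennreal (e powr (1 - q)) * (\<integral>\<^sup>+x. ennreal (g k x powr q) \<partial>M)" for k
    proof -
      have "(\<integral>\<^sup>+x. ennreal (g k x) \<partial>M) \<le> (\<integral>\<^sup>+x. ennreal e + ennreal (e powr (1 - q)) * ennreal (g k x powr q) \<partial>M)"
      proof (rule nn_integral_mono)
        fix x
        have "ennreal (g k x) \<le> ennreal (e + e powr (1 - q) * g k x powr q)"
          using young[OF that nn] by (rule ennreal_leI)
        also have "\<dots> = ennreal e + ennreal (e powr (1 - q)) * ennreal (g k x powr q)"
          using that by (simp add: ennreal_plus ennreal_mult)
        finally show "ennreal (g k x) \<le> ennreal e + ennreal (e powr (1 - q)) * ennreal (g k x powr q)" .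
      qed
      also have "\<dots> = emeasure M (space M) * ennreal e + ennreal (e powr (1 - q)) * (\<integral>\<^sup>+x. ennreal (g k x powr q) \<partial>M)"
        by (subst nn_integral_add) (auto simp: nn_integral_cmult mult.commute)
      finally show ?thesis .
    qed
    then have "limsup (\<lambda>k. \<integral>\<^sup>+x. ennreal (g k x) \<partial>M)
        \<le> limsup (\<lambda>k. emeasure M (space M) * ennreal e + ennreal (e powr (1 - q)) * (\<integral>\<^sup>+x. ennreal (g k x powr q) \<partial>M))"
      by (intro Limsup_mono) auto
    also have "(\<lambda>k. emeasure M (space M) * ennreal e + ennreal (e powr (1 - q)) * (\<integral>\<^sup>+x. ennreal (g k x powr q) \<partial>M))
        \<longlonglongrightarrow> emeasure M (space M) * ennreal e + ennreal (e powr (1 - q)) * 0"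
      by (intro tendsto_add tendsto_const ennreal_tendsto_cmult lim) auto
    then have "limsup (\<lambda>k. emeasure M (space M) * ennreal e + ennreal (e powr (1 - q)) * (\<integral>\<^sup>+x. ennreal (g k x powr q) \<partial>M))
       = emeasure M (space M) * ennreal e"
      by (simp add: lim_imp_Limsup)
    finally show ?thesis .
  qed
  have "((\<lambda>e. emeasure M (space M) * ennreal e) \<longlongrightarrow> emeasure M (space M) * ennreal 0) (at_right 0)"
    using fin by (intro ennreal_tendsto_cmult tendsto_ennrealI tendsto_ident_at) auto
  then have "limsup (\<lambda>k. \<integral>\<^sup>+x. ennreal (g k x) \<partial>M) \<le> emeasure M (space M) * ennreal 0"
    by (rule tendsto_lowerbound) (use le in \<open>auto simp: eventually_at_filter\<close>)
  then show ?thesis by (intro tendsto_0_if_Limsup_eq_0_ennreal) simp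
qed

text \<open>The integrand may change sign, and \<open>ennreal\<close> cuts off its negative part.
  The affine lower bound for the energy calls for this, being negative where the trace is very
  negative.\<close>

lemma integral_le_nn_integral:
  fixes f :: "'a \<Rightarrow> real"
  assumes "integrable M f"
  shows "ennreal (LINT x|M. f x) \<le> (\<integral>\<^sup>+x. ennreal (f x) \<partial>M)"
proof -
  have "ennreal (LINT x|M. f x) \<le> ennreal (LINT x|M. max 0 (f x))"
    using assms by (intro ennreal_leI integral_mono) auto
  also have "\<dots> = (\<integral>\<^sup>+x. ennreal (max 0 (f x)) \<partial>M)"
    using assms by (intro nn_integral_eq_integral[symmetric]) auto
  also have "\<dots> = (\<integral>\<^sup>+x. ennreal (f x) \<partial>M)"
    by (intro nn_integral_cong) (simp add: max_def ennreal_neg)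
  finally show ?thesis .
qed

lemma integrable_if_Lq:
  fixes f :: "'a \<Rightarrow> 'b::{banach, second_countable_topology}"
  assumes "Lq M q f" "emeasure M (space M) < \<infinity>" "q > 1"
  shows "integrable M f"
proof -
  interpret finite_measure M using assms(2) by (intro finite_measureI) (auto simp: less_top)
  have int: "integrable M (\<lambda>x. 1 + norm (f x) powr q)"
    using assms(1) by (simp add: Lq_def)
  show ?thesis
  proof (rule Bochner_Integration.integrable_bound[OF int])
    show "f \<in> borel_measurable M" using assms by (simp add: Lq_def)
    show "AE x in M. norm (f x) \<le> norm (1 + norm (f x) powr q)"
    proof (rule AE_I2)
      fix x
      show "norm (f x) \<le> norm (1 + norm (f x) powr q)"
      proof (cases "norm (f x) \<le> 1")
        case False
        then have "norm (f x) powr 1 \<le> norm (f x) powr q" using assms(3) by (intro powr_mono) auto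
        then show ?thesis using False by simp
      qed (simp add: add_increasing2)
    qed
  qed
qed

lemma smooth_imp_C1:
  assumes "smooth f"
  shows "f differentiable (at x)" "continuous_on UNIV f"
    "continuous_on UNIV (\<lambda>x. frechet_derivative f (at x) v)"
proof -
  have "Ck 0 f" "Ck (Suc 0) f" using assms unfolding smooth_def by blast+
  then show "f differentiable (at x)" "continuous_on UNIV f"
    "continuous_on UNIV (\<lambda>x. frechet_derivative f (at x) v)" by auto
qed

lemma directional_derivative:
  fixes f :: "'a::real_normed_vector \<Rightarrow> 'b::real_normed_vector"
  assumes "f differentiable (at x)"
  shows "((\<lambda>s. f (x + s *\<^sub>R v)) has_vector_derivative frechet_derivative f (at x) v) (at 0)"
proof -
  have "(f has_derivative frechet_derivative f (at x)) (at (x + 0 *\<^sub>R v))"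
    using assms by (simp add: frechet_derivative_works)
  moreover have "((\<lambda>s. x + s *\<^sub>R v) has_derivative (\<lambda>s. s *\<^sub>R v)) (at 0)"
    by (auto intro!: derivative_eq_intros)
  ultimately have "((\<lambda>s. f (x + s *\<^sub>R v)) has_derivative (\<lambda>s. frechet_derivative f (at x) (s *\<^sub>R v))) (at 0)"
    by (rule has_derivative_compose[rotated])
  then show ?thesis
    using linear_cmul[OF linear_frechet_derivative[OF assms]] by (simp add: has_vector_derivative_def)
qed

lemma integral_lebesgue_on_eq_lborel:
  fixes f :: "plane \<Rightarrow> real"
  assumes "open \<Omega>" "f \<in> borel_measurable borel"
  shows "(LINT x|lebesgue_on \<Omega>. f x) = (LINT x:\<Omega>|lborel. f x)"
proof -
  have [measurable]: "\<Omega> \<in> sets borel" "f \<in> borel_measurable borel" using assms by auto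
  have "(LINT x|lebesgue_on \<Omega>. f x) = (LINT x|lebesgue. indicator \<Omega> x *\<^sub>R f x)"
    by (rule integral_restrict_space) auto
  also have "\<dots> = (LINT x:\<Omega>|lborel. f x)"
    unfolding set_lebesgue_integral_def by (rule integral_completion) simp
  finally show ?thesis .
qed

lemma integrable_lebesgue_on_continuous:
  fixes f :: "plane \<Rightarrow> real"
  assumes "open \<Omega>" "bounded \<Omega>" "continuous_on UNIV f"
  shows "integrable (lebesgue_on \<Omega>) f"
proof -
  have [measurable]: "\<Omega> \<in> sets borel" "f \<in> borel_measurable borel"
    using assms by (auto intro: borel_measurable_continuous_onI)
  have "integrable lborel (\<lambda>x. indicator \<Omega> x *\<^sub>R f x)"
    using set_integrable_continuous_bounded[OF assms(3,2)] by (simp add: set_integrable_def)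
  then have "integrable lebesgue (\<lambda>x. indicator \<Omega> x *\<^sub>R f x)" by (subst integrable_completion) auto
  then show ?thesis by (subst integrable_restrict_space) auto
qed

lemma emeasure_lebesgue_on_finite: "open \<Omega> \<Longrightarrow> bounded \<Omega> \<Longrightarrow> emeasure (lebesgue_on \<Omega>) (space (lebesgue_on \<Omega>)) < \<infinity>"
  for \<Omega> :: "plane set"
  using emeasure_bounded_finite[of \<Omega>] by (simp add: emeasure_restrict_space)

text \<open>The boundary estimate is applied to the i-th component of \<open>v k\<close> minus the
  dilation. Its right-hand side tends to 0 by the definition of the trace, and the integrals over
  \<Omega> converge to that of the weak gradient: both measures are finite, so L^q convergence
  passes to L^1.\<close>

lemma integral_weak_gradient_trace:
  fixes \<Omega> :: "plane set" and u :: "plane \<Rightarrow> plane" and i :: 2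
  assumes \<Omega>: "open \<Omega>" "bounded \<Omega>" "lipschitz_boundary \<Omega>" and q: "q > 1"
    and G: "Lq (lebesgue_on \<Omega>) q (weak_gradient \<Omega> u)" and tr: "has_trace \<Omega> q u (dilation c)"
  shows "(LINT x|lebesgue_on \<Omega>. weak_gradient \<Omega> u x $ i $ i) = (LINT x|lebesgue_on \<Omega>. c)"
proof -
  let ?M = "lebesgue_on \<Omega>" and ?B = "boundary_measure \<Omega>" and ?G = "weak_gradient \<Omega> u"
  obtain v where v: "\<And>k. smooth (v k)"
    and vG: "Lq_tendsto ?M q (\<lambda>k x. matrix (frechet_derivative (v k) (at x))) ?G"
    and vB: "Lq_tendsto ?B q v (dilation c)"
    using tr unfolding has_trace_def by blast
  define D where "D k x = frechet_derivative (v k) (at x) (axis i 1) $ i" for k x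
  define w where "w k x = v k x $ i - c * x $ i" for k x
  have mD: "matrix (frechet_derivative (v k) (at x)) $ i $ i = D k x" for k x
    by (simp add: matrix_def D_def)
  have contD: "continuous_on UNIV (D k)" for k
    unfolding D_def by (intro continuous_intros smooth_imp_C1 v)
  have contv: "continuous_on UNIV (v k)" for k by (rule smooth_imp_C1[OF v])
  have contw: "continuous_on UNIV (w k)" for k
    unfolding w_def by (intro continuous_intros contv)
  have intD: "integrable ?M (D k)" for k
    by (rule integrable_lebesgue_on_continuous[OF \<Omega>(1,2) contD])
  have intG: "integrable ?M ?G"
    using G emeasure_lebesgue_on_finite[OF \<Omega>(1,2)] q by (rule integrable_if_Lq)
  then have intGi: "integrable ?M (\<lambda>x. ?G x $ i $ i)"
    using integrable_bounded_linear[OF bounded_linear_vec_nth[of i] integrable_bounded_linear[OF bounded_linear_vec_nth[of i] intG]] by simp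
  have intc: "integrable ?M (\<lambda>x. c)"
    by (rule integrable_lebesgue_on_continuous[OF \<Omega>(1,2)]) simp
  have bd: "ennreal \<bar>(LINT x|?M. D k x) - (LINT x|?M. c)\<bar> \<le> 2 * (\<integral>\<^sup>+x. ennreal (norm (v k x - dilation c x)) \<partial>?B)" for k
  proof -
    have "(LINT x|?M. D k x) - (LINT x|?M. c) = (LINT x|?M. D k x - c)"
      using intD intc by simp
    also have "\<dots> = (LINT x:\<Omega>|lborel. D k x - c)"
      using contD \<Omega>(1) by (intro integral_lebesgue_on_eq_lborel) (auto intro!: borel_measurable_continuous_onI continuous_intros)
    finally have "ennreal \<bar>(LINT x|?M. D k x) - (LINT x|?M. c)\<bar> = ennreal \<bar>LINT x:\<Omega>|lborel. D k x - c\<bar>" by simp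
    also have "\<dots> \<le> 2 * (\<integral>\<^sup>+x\<in>frontier \<Omega>. ennreal \<bar>w k x\<bar> \<partial>hausdorff1)"
    proof (rule integral_partial_le_boundary_integral[OF \<Omega>(1,2) hausdorff1_outer_lipschitz_boundary[OF \<Omega>] contw, where j=i])
      show "continuous_on UNIV (\<lambda>x. D k x - c)" by (intro continuous_intros contD)
      show "((\<lambda>s. w k (x + s *\<^sub>R axis i 1)) has_real_derivative D k x - c) (at 0)" for x
      proof -
        have "((\<lambda>s. v k (x + s *\<^sub>R axis i 1) $ i) has_vector_derivative D k x) (at 0)"
          unfolding D_def by (intro bounded_linear.has_vector_derivative[OF bounded_linear_vec_nth] directional_derivative smooth_imp_C1 v)
        then have 1: "((\<lambda>s. v k (x + s *\<^sub>R axis i 1) $ i) has_real_derivative D k x) (at 0)"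
          by (simp add: has_real_derivative_iff_has_vector_derivative)
        show ?thesis unfolding w_def by (auto intro!: derivative_eq_intros 1)
      qed
    qed
    also have "(\<integral>\<^sup>+x\<in>frontier \<Omega>. ennreal \<bar>w k x\<bar> \<partial>hausdorff1) \<le> (\<integral>\<^sup>+x\<in>frontier \<Omega>. ennreal (norm (v k x - dilation c x)) \<partial>hausdorff1)"
    proof (intro nn_integral_mono mult_right_mono ennreal_leI)
      fix x show "\<bar>w k x\<bar> \<le> norm (v k x - dilation c x)"
        using component_le_norm_cart[of "v k x - dilation c x" i] by (simp add: w_def dilation_def)
    qed simp
    also have "\<dots> = (\<integral>\<^sup>+x. ennreal (norm (v k x - dilation c x)) \<partial>?B)"
      by (subst nn_integral_restrict_space) auto
    finally show ?thesis by (simp add: mult_left_mono)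
  qed
  have B0: "(\<lambda>k. \<integral>\<^sup>+x. ennreal (norm (v k x - dilation c x)) \<partial>?B) \<longlonglongrightarrow> 0"
  proof (rule nn_integral_tendsto_0_if_powr[OF _ q])
    have [measurable]: "frontier \<Omega> \<in> sets borel" by auto
    show "emeasure ?B (space ?B) < \<infinity>"
      using hausdorff1_outer_lipschitz_boundary[OF \<Omega>]
      by (simp add: emeasure_restrict_space space_restrict_space emeasure_hausdorff1)
    show "(\<lambda>x. norm (v k x - dilation c x)) \<in> borel_measurable ?B" for k
    proof (rule measurable_restrict_space1)
      have "(\<lambda>x. norm (v k x - dilation c x)) \<in> borel_measurable borel"
        using contv unfolding dilation_def by (intro borel_measurable_continuous_onI continuous_intros) auto
      then show "(\<lambda>x. norm (v k x - dilation c x)) \<in> borel_measurable hausdorff1" by simp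
    qed
  qed (use vB in \<open>auto simp: Lq_tendsto_def\<close>)
  have M0: "(\<lambda>k. \<integral>\<^sup>+x. ennreal \<bar>D k x - ?G x $ i $ i\<bar> \<partial>?M) \<longlonglongrightarrow> 0"
  proof (rule nn_integral_tendsto_0_if_powr[OF emeasure_lebesgue_on_finite[OF \<Omega>(1,2)] q])
    show "(\<lambda>x. \<bar>D k x - ?G x $ i $ i\<bar>) \<in> borel_measurable ?M" for k
      using borel_measurable_integrable[OF intD[of k]] borel_measurable_integrable[OF intGi] by simp
    have "(\<integral>\<^sup>+x. ennreal (\<bar>D k x - ?G x $ i $ i\<bar> powr q) \<partial>?M)
        \<le> (\<integral>\<^sup>+x. ennreal (norm (matrix (frechet_derivative (v k) (at x)) - ?G x) powr q) \<partial>?M)" for k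
    proof (intro nn_integral_mono ennreal_leI powr_mono2)
      fix x
      let ?A = "matrix (frechet_derivative (v k) (at x)) - ?G x"
      have "\<bar>D k x - ?G x $ i $ i\<bar> = \<bar>?A $ i $ i\<bar>" by (simp add: mD)
      also have "\<dots> \<le> norm (?A $ i)" by (rule component_le_norm_cart)
      also have "\<dots> \<le> norm ?A" by (rule Finite_Cartesian_Product.norm_nth_le)
      finally show "\<bar>D k x - ?G x $ i $ i\<bar> \<le> norm ?A" .
    qed (use q in auto)
    then show "(\<lambda>k. \<integral>\<^sup>+x. ennreal (\<bar>D k x - ?G x $ i $ i\<bar> powr q) \<partial>?M) \<longlonglongrightarrow> 0"
      by (intro tendsto_sandwich[OF _ _ tendsto_const vG[unfolded Lq_tendsto_def]] always_eventually allI) auto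
  qed simp
  \<comment> \<open>Triangle inequality through the integral of \<open>D k\<close>: the left-hand
    side is independent of k, and the right-hand side tends to 0.\<close>
  have "ennreal \<bar>(LINT x|?M. ?G x $ i $ i) - (LINT x|?M. c)\<bar> \<le>
     (\<integral>\<^sup>+x. ennreal \<bar>D k x - ?G x $ i $ i\<bar> \<partial>?M) + 2 * (\<integral>\<^sup>+x. ennreal (norm (v k x - dilation c x)) \<partial>?B)" for k
  proof -
    have "ennreal \<bar>(LINT x|?M. D k x) - (LINT x|?M. ?G x $ i $ i)\<bar> = ennreal (norm (LINT x|?M. D k x - ?G x $ i $ i))"
      using intD intGi by simp
    also have "\<dots> \<le> (\<integral>\<^sup>+x. ennreal (norm (D k x - ?G x $ i $ i)) \<partial>?M)"
      using intD intGi by (intro integral_norm_bound_ennreal) auto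
    finally have 1: "ennreal \<bar>(LINT x|?M. D k x) - (LINT x|?M. ?G x $ i $ i)\<bar> \<le> (\<integral>\<^sup>+x. ennreal \<bar>D k x - ?G x $ i $ i\<bar> \<partial>?M)"
      by simp
    have "ennreal \<bar>(LINT x|?M. ?G x $ i $ i) - (LINT x|?M. c)\<bar> \<le>
      ennreal (\<bar>(LINT x|?M. D k x) - (LINT x|?M. ?G x $ i $ i)\<bar> + \<bar>(LINT x|?M. D k x) - (LINT x|?M. c)\<bar>)"
      by (intro ennreal_leI) linarith
    also have "\<dots> = ennreal \<bar>(LINT x|?M. D k x) - (LINT x|?M. ?G x $ i $ i)\<bar> + ennreal \<bar>(LINT x|?M. D k x) - (LINT x|?M. c)\<bar>"
      by (simp add: ennreal_plus)
    also note add_mono[OF 1 bd]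
    finally show ?thesis .
  qed
  moreover have "(\<lambda>k. (\<integral>\<^sup>+x. ennreal \<bar>D k x - ?G x $ i $ i\<bar> \<partial>?M) + 2 * (\<integral>\<^sup>+x. ennreal (norm (v k x - dilation c x)) \<partial>?B)) \<longlonglongrightarrow> 0 + 2 * 0"
    by (intro tendsto_add M0 ennreal_tendsto_cmult B0) simp
  ultimately have "ennreal \<bar>(LINT x|?M. ?G x $ i $ i) - (LINT x|?M. c)\<bar> \<le> 0 + 2 * 0"
    by (intro LIMSEQ_le_const) auto
  then show ?thesis by (simp add: ennreal_eq_0_iff)
qed

section \<open>The weak gradient of a dilation\<close>

lemma test_function_zero_outside: "test_function \<Omega> \<phi> \<Longrightarrow> x \<notin> \<Omega> \<Longrightarrow> \<phi> x = 0"
  unfolding test_function_def using closure_subset[of "{x. \<phi> x \<noteq> 0}"] by auto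

text \<open>Integration by parts is once more the boundary estimate, applied to the product of c x_i
  and \<phi>: this vanishes on the frontier, so its partial derivatives have integral 0.\<close>

lemma has_weak_gradient_dilation:
  assumes \<Omega>: "open \<Omega>" "bounded \<Omega>" "lipschitz_boundary \<Omega>"
  shows "has_weak_gradient \<Omega> (dilation c) (\<lambda>_. mat c)"
  unfolding has_weak_gradient_def
proof (intro conjI allI impI)
  fix K :: "plane set" assume "compact K \<and> K \<subseteq> \<Omega>"
  then have K: "compact K" and [measurable]: "K \<in> sets borel" by (auto dest: compact_imp_closed intro: borel_closed)
  have "integrable lborel (\<lambda>x. indicator K x *\<^sub>R dilation c x)"
    unfolding dilation_def by (intro borel_integrable_compact K continuous_intros)
  then show "set_integrable lebesgue K (dilation c)"
    unfolding set_integrable_def by (subst integrable_completion) auto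
  have "integrable lborel (\<lambda>x. indicator K x *\<^sub>R (mat c :: mat2))"
    by (intro borel_integrable_compact K continuous_intros)
  then show "set_integrable lebesgue K (\<lambda>_. mat c :: mat2)"
    unfolding set_integrable_def by (subst integrable_completion) auto
next
  fix \<phi> and i j :: 2 assume \<phi>: "test_function \<Omega> \<phi>"
  then have sm: "smooth \<phi>" by (simp add: test_function_def)
  let ?M = "lebesgue_on \<Omega>"
  define w where "w x = c * x $ i * \<phi> x" for x :: plane
  define \<delta> where "\<delta> = (mat c :: mat2) $ i $ j"
  have \<delta>: "\<delta> = c * axis j 1 $ i" by (simp add: \<delta>_def mat_def axis_def)
  define D1 where "D1 x = dilation c x $ i * frechet_derivative \<phi> (at x) (axis j 1)" for x
  define D2 where "D2 x = \<delta> * \<phi> x" for x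
  have c1: "continuous_on UNIV D1" unfolding D1_def dilation_def by (intro continuous_intros smooth_imp_C1 sm)
  have c2: "continuous_on UNIV D2" unfolding D2_def by (intro continuous_intros smooth_imp_C1 sm)
  have "ennreal \<bar>LINT x:\<Omega>|lborel. D1 x + D2 x\<bar> \<le> 2 * (\<integral>\<^sup>+x\<in>frontier \<Omega>. ennreal \<bar>w x\<bar> \<partial>hausdorff1)"
  proof (rule integral_partial_le_boundary_integral[OF \<Omega>(1,2) hausdorff1_outer_lipschitz_boundary[OF \<Omega>], where j=j])
    show "continuous_on UNIV w" unfolding w_def by (intro continuous_intros smooth_imp_C1 sm)
    show "continuous_on UNIV (\<lambda>x. D1 x + D2 x)" by (intro continuous_intros c1 c2)
    show "((\<lambda>s. w (x + s *\<^sub>R axis j 1)) has_real_derivative D1 x + D2 x) (at 0)" for x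
    proof -
      have 1: "((\<lambda>s. \<phi> (x + s *\<^sub>R axis j 1)) has_real_derivative frechet_derivative \<phi> (at x) (axis j 1)) (at 0)"
        unfolding has_real_derivative_iff_has_vector_derivative
        by (intro directional_derivative smooth_imp_C1 sm)
      show ?thesis unfolding w_def
        by (auto intro!: derivative_eq_intros 1 simp: D1_def D2_def dilation_def \<delta>)
    qed
  qed
  also have "(\<integral>\<^sup>+x\<in>frontier \<Omega>. ennreal \<bar>w x\<bar> \<partial>hausdorff1) = (\<integral>\<^sup>+x. 0 \<partial>hausdorff1)"
  proof (rule nn_integral_cong)
    fix x
    show "ennreal \<bar>w x\<bar> * indicator (frontier \<Omega>) x = 0"
      using test_function_zero_outside[OF \<phi>, of x] \<Omega>(1)
      by (cases "x \<in> \<Omega>") (auto simp: w_def frontier_def interior_open)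
  qed
  finally have "(LINT x:\<Omega>|lborel. D1 x + D2 x) = 0" by (simp add: ennreal_eq_0_iff)
  moreover have "(LINT x:\<Omega>|lborel. D1 x + D2 x) = (LINT x|?M. D1 x + D2 x)"
    using c1 c2 \<Omega>(1) by (intro integral_lebesgue_on_eq_lborel[symmetric]) (auto intro!: borel_measurable_continuous_onI continuous_intros)
  moreover have "\<dots> = (LINT x|?M. D1 x) + (LINT x|?M. D2 x)"
    using integrable_lebesgue_on_continuous[OF \<Omega>(1,2) c1] integrable_lebesgue_on_continuous[OF \<Omega>(1,2) c2] by simp
  ultimately show "(LINT x|?M. dilation c x $ i * frechet_derivative \<phi> (at x) (axis j 1)) = - (LINT x|?M. (mat c :: mat2) $ i $ j * \<phi> x)"
    unfolding D1_def[symmetric] \<delta>_def[symmetric] D2_def[symmetric] by linarith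
qed

lemma integrable_times_test_function:
  fixes F \<phi> :: "plane \<Rightarrow> real"
  assumes "open \<Omega>" and loc: "\<And>K. compact K \<Longrightarrow> K \<subseteq> \<Omega> \<Longrightarrow> set_integrable lebesgue K F"
    and \<phi>: "test_function \<Omega> \<phi>"
  shows "integrable (lebesgue_on \<Omega>) (\<lambda>x. F x * \<phi> x)"
proof -
  define K where "K = closure {x. \<phi> x \<noteq> 0}"
  have K: "compact K" "K \<subseteq> \<Omega>" and sm: "smooth \<phi>" using \<phi> by (auto simp: test_function_def K_def)
  have cont: "continuous_on UNIV \<phi>" using sm by (rule smooth_imp_C1)
  have "bounded (\<phi> ` K)" using K(1) continuous_on_subset[OF cont] by (intro compact_imp_bounded compact_continuous_image) auto
  then obtain B where B: "\<And>x. x \<in> K \<Longrightarrow> \<bar>\<phi> x\<bar> \<le> B" by (auto simp: bounded_real)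
  have int: "integrable lebesgue (\<lambda>x. indicator K x *\<^sub>R F x)" using loc[OF K] by (simp add: set_integrable_def)
  have m\<phi>: "\<phi> \<in> borel_measurable lebesgue"
    by (rule measurable_completion) (simp add: borel_measurable_continuous_onI[OF cont])
  have 0: "\<phi> x = 0" if "x \<notin> K" for x using that closure_subset[of "{x. \<phi> x \<noteq> 0}"] by (auto simp: K_def)
  have "integrable lebesgue (\<lambda>x. (indicator K x *\<^sub>R F x) * \<phi> x)"
  proof (rule Bochner_Integration.integrable_bound)
    show "integrable lebesgue (\<lambda>x. B * (indicator K x *\<^sub>R F x))" using int by (rule integrable_mult_right)
    show "(\<lambda>x. (indicator K x *\<^sub>R F x) * \<phi> x) \<in> borel_measurable lebesgue"
      using borel_measurable_integrable[OF int] m\<phi> by (rule borel_measurable_times)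
    show "AE x in lebesgue. norm ((indicator K x *\<^sub>R F x) * \<phi> x) \<le> norm (B * (indicator K x *\<^sub>R F x))"
    proof (rule AE_I2)
      fix x
      show "norm ((indicator K x *\<^sub>R F x) * \<phi> x) \<le> norm (B * (indicator K x *\<^sub>R F x))"
      proof (cases "x \<in> K")
        case True
        have "\<bar>F x\<bar> * \<bar>\<phi> x\<bar> \<le> \<bar>F x\<bar> * \<bar>B\<bar>" using B[OF True] by (intro mult_left_mono) auto
        then show ?thesis using True by (simp add: abs_mult mult.commute)
      qed simp
    qed
  qed
  also have "(\<lambda>x. (indicator K x *\<^sub>R F x) * \<phi> x) = (\<lambda>x. indicator \<Omega> x *\<^sub>R (F x * \<phi> x))"
    using 0 K(2) by (auto simp: fun_eq_iff indicator_def)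
  finally show ?thesis using \<open>open \<Omega>\<close> by (subst integrable_restrict_space) auto
qed

text \<open>\<open>weak_gradient\<close> is an arbitrary choice among all weak gradients, so the
  energy of a concrete map such as the dilation becomes accessible only through uniqueness almost
  everywhere.\<close>

lemma weak_gradient_unique:
  assumes "open \<Omega>" and G: "has_weak_gradient \<Omega> u G" and H: "has_weak_gradient \<Omega> u H"
  shows "AE x in lebesgue_on \<Omega>. G x = H x"
proof -
  have loc: "set_integrable lebesgue K (\<lambda>x. G x $ i $ j)" if "has_weak_gradient \<Omega> u G" "compact K" "K \<subseteq> \<Omega>" for G K i j
  proof -
    have "integrable lebesgue (\<lambda>x. indicator K x *\<^sub>R G x)"
      using that unfolding has_weak_gradient_def set_integrable_def by blast
    from integrable_bounded_linear[OF bounded_linear_vec_nth[of j] integrable_bounded_linear[OF bounded_linear_vec_nth[of i] this]]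
    show ?thesis by (simp add: set_integrable_def)
  qed
  have "AE x in lebesgue. x \<in> \<Omega> \<longrightarrow> G x $ i $ j - H x $ i $ j = 0" for i j
  proof (rule AE_zero_if_test_integrals_zero[OF \<open>open \<Omega>\<close>])
    show "set_integrable lebesgue K (\<lambda>x. G x $ i $ j - H x $ i $ j)" if "compact K" "K \<subseteq> \<Omega>" for K
      using loc[OF G that] loc[OF H that] by (rule set_integral_diff)
    show "(LINT x|lebesgue_on \<Omega>. (G x $ i $ j - H x $ i $ j) * \<phi> x) = 0" if \<phi>: "test_function \<Omega> \<phi>" for \<phi>
    proof -
      have "(LINT x|lebesgue_on \<Omega>. G x $ i $ j * \<phi> x) = (LINT x|lebesgue_on \<Omega>. H x $ i $ j * \<phi> x)"
      proof -
        have "(LINT x|lebesgue_on \<Omega>. u x $ i * frechet_derivative \<phi> (at x) (axis j 1)) = - (LINT x|lebesgue_on \<Omega>. G x $ i $ j * \<phi> x)"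
          if "has_weak_gradient \<Omega> u G" for G
          using that \<phi> by (simp add: has_weak_gradient_def)
        from this[OF G] this[OF H] show ?thesis by simp
      qed
      then show ?thesis
        using integrable_times_test_function[OF \<open>open \<Omega>\<close> loc[OF G] \<phi>] integrable_times_test_function[OF \<open>open \<Omega>\<close> loc[OF H] \<phi>]
        by (simp add: left_diff_distrib)
    qed
  qed
  then have "AE x in lebesgue. \<forall>i j. x \<in> \<Omega> \<longrightarrow> G x $ i $ j - H x $ i $ j = 0"
    unfolding AE_all_countable by blast
  then have "AE x in lebesgue. x \<in> \<Omega> \<longrightarrow> G x = H x"
    by eventually_elim (auto simp: vec_eq_iff)
  then show ?thesis using \<open>open \<Omega>\<close> by (subst AE_restrict_space_iff) auto
qed

lemma weak_gradient_dilation: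
  assumes \<Omega>: "open \<Omega>" "bounded \<Omega>" "lipschitz_boundary \<Omega>"
  shows "AE x in lebesgue_on \<Omega>. weak_gradient \<Omega> (dilation c) x = mat c"
proof -
  have "has_weak_gradient \<Omega> (dilation c) (weak_gradient \<Omega> (dilation c))"
    unfolding weak_gradient_def using has_weak_gradient_dilation[OF \<Omega>, of c] by (rule someI[of "has_weak_gradient \<Omega> (dilation c)"])
  then show ?thesis
    using weak_gradient_unique[OF \<Omega>(1) _ has_weak_gradient_dilation[OF \<Omega>]] by blast
qed

section \<open>The energy comparison\<close>

text \<open>Finiteness of h at positive arguments makes \<open>enn2real\<close> faithful there,
  which carries the real inequality over to \<open>ennreal\<close>; where the affine side is
  negative, \<open>ennreal\<close> replaces it by 0.\<close>

lemma stored_energy_above_affine: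
  fixes A :: mat2 and h :: "real \<Rightarrow> ennreal"
  defines "hr \<equiv> \<lambda>t. enn2real (h t)"
  assumes q: "1 < q" "q < 2" and h_finite: "\<forall>t>0. h t < \<infinity>" and convex: "convex_on {0<..} hr"
    and diff: "hr differentiable (at (c\<^sup>2))" and c: "c > 0" and m: "deriv hr (c\<^sup>2) > 0"
    and cond: "1 / (2 powr (3 - q) * deriv hr (c\<^sup>2) * c powr (2 - q)) \<ge> (q - 1) powr ((q - 1) / 2) * q powr (- q / 2)"
    and A: "det A > 0"
  shows "stored_energy q h A \<ge> ennreal (frob (mat c) powr q + hr (c\<^sup>2)
     + c powr (q - 1) * (q * 2 powr (q / 2 - 1) + deriv hr (c\<^sup>2) * c powr (2 - q)) * (trace A - 2 * c))"
proof -
  have "(hr has_field_derivative deriv hr (c\<^sup>2)) (at (c\<^sup>2) within {0<..})"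
    using diff real_differentiable_def DERIV_deriv_iff_real_differentiable has_field_derivative_at_within by blast
  then have "hr (det A) - hr (c\<^sup>2) \<ge> deriv hr (c\<^sup>2) * (det A - c\<^sup>2)"
    using convex A c by (intro convex_on_imp_above_tangent[of "{0<..}"]) (auto simp: interior_open)
  moreover note polyconvex_part_bound[OF q m c A cond]
  ultimately have "frob (mat c) powr q + hr (c\<^sup>2)
     + c powr (q - 1) * (q * 2 powr (q / 2 - 1) + deriv hr (c\<^sup>2) * c powr (2 - q)) * (trace A - 2 * c)
     \<le> frob A powr q + hr (det A)"
    by (simp add: right_diff_distrib)
  then have "ennreal (frob (mat c) powr q + hr (c\<^sup>2)
     + c powr (q - 1) * (q * 2 powr (q / 2 - 1) + deriv hr (c\<^sup>2) * c powr (2 - q)) * (trace A - 2 * c))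
    \<le> ennreal (frob A powr q + hr (det A))" by (rule ennreal_leI)
  also have "\<dots> = stored_energy q h A"
    using h_finite A by (simp add: stored_energy_def hr_def ennreal_plus)
  finally show ?thesis .
qed

theorem theorem2p10:
  fixes \<Omega> :: "(real^2) set" and q c :: real and h :: "real \<Rightarrow> ennreal"
  assumes "open \<Omega>" and "connected \<Omega>" and "\<Omega> \<noteq> {}" and "bounded \<Omega>"
    and "lipschitz_boundary \<Omega>"
    and "1 < q" and "q < 2"
    and h_finite: "\<forall>t>0. h t < \<infinity>"
    and h_convex: "convex_on {0<..} (\<lambda>t. enn2real (h t))"
    and h_C1: "\<forall>t>0. (\<lambda>s. enn2real (h s)) differentiable (at t)"
      "continuous_on {0<..} (deriv (\<lambda>s. enn2real (h s)))"
    and h_zero: "(h \<longlongrightarrow> \<infinity>) (at_right 0)"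
    and h_growth: "Liminf at_top (\<lambda>t. h t / ennreal t) > 0"
    and h_nonpos: "\<forall>t\<le>0. h t = \<infinity>"
    and "c > 0"
    and "deriv (\<lambda>s. enn2real (h s)) (c\<^sup>2) > 0"
    and "1 / (2 powr (3 - q) * deriv (\<lambda>s. enn2real (h s)) (c\<^sup>2) * c powr (2 - q))
         \<ge> (q - 1) powr ((q - 1) / 2) * q powr (- q / 2)"
  shows "\<forall>u \<in> admissible \<Omega> q c. energy \<Omega> q h u \<ge> energy \<Omega> q h (dilation c)"
proof
  fix u assume u: "u \<in> admissible \<Omega> q c"
  let ?M = "lebesgue_on \<Omega>" and ?G = "weak_gradient \<Omega> u" and ?hr = "\<lambda>s. enn2real (h s)"
  note \<Omega> = \<open>open \<Omega>\<close> \<open>bounded \<Omega>\<close> \<open>lipschitz_boundary \<Omega>\<close>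
  define W where "W = frob (mat c) powr q + ?hr (c\<^sup>2)"
  define \<kappa> where "\<kappa> = c powr (q - 1) * (q * 2 powr (q / 2 - 1) + deriv ?hr (c\<^sup>2) * c powr (2 - q))"
  have G: "Lq ?M q ?G" and tr: "has_trace \<Omega> q u (dilation c)" and det: "AE x in ?M. det (?G x) > 0"
    using u by (auto simp: admissible_def sobolev_def)
  have intG: "integrable ?M ?G"
    using G emeasure_lebesgue_on_finite[OF \<Omega>(1,2)] \<open>1 < q\<close> by (rule integrable_if_Lq)
  have intGi: "integrable ?M (\<lambda>x. ?G x $ i $ i)" for i
    using integrable_bounded_linear[OF bounded_linear_vec_nth[of i] integrable_bounded_linear[OF bounded_linear_vec_nth[of i] intG]] by simp
  have intc: "integrable ?M (\<lambda>x. a)" for a :: real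
    by (rule integrable_lebesgue_on_continuous[OF \<Omega>(1,2)]) simp
  have int: "integrable ?M (\<lambda>x. W + \<kappa> * (trace (?G x) - 2 * c))"
    using intGi intc by (simp add: trace_def sum_2)
  have W0: "W \<ge> 0" by (simp add: W_def)
  have "energy \<Omega> q h (dilation c) = (\<integral>\<^sup>+x. stored_energy q h (mat c) \<partial>?M)"
    unfolding energy_def using weak_gradient_dilation[OF \<Omega>, of c]
    by (intro nn_integral_cong_AE) (auto elim!: eventually_mono)
  also have "stored_energy q h (mat c) = ennreal W"
    using h_finite \<open>c > 0\<close> by (simp add: stored_energy_def W_def ennreal_plus det_2 mat_def power2_eq_square)
  also have "(\<integral>\<^sup>+x. ennreal W \<partial>?M) = ennreal (LINT x|?M. W)"
    using intc W0 by (intro nn_integral_eq_integral) auto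
  \<comment> \<open>Both diagonal entries of the weak gradient have mean c, so the term with
    \<kappa> integrates to 0.\<close>
  also have "(LINT x|?M. W) = (LINT x|?M. W + \<kappa> * (trace (?G x) - 2 * c))"
    using intGi intc integral_weak_gradient_trace[OF \<Omega> \<open>1 < q\<close> G tr] by (simp add: trace_def sum_2)
  also have "ennreal \<dots> \<le> (\<integral>\<^sup>+x. ennreal (W + \<kappa> * (trace (?G x) - 2 * c)) \<partial>?M)"
    by (rule integral_le_nn_integral[OF int])
  also have "\<dots> \<le> energy \<Omega> q h u"
    unfolding energy_def
  proof (rule nn_integral_mono_AE)
    show "AE x in ?M. ennreal (W + \<kappa> * (trace (?G x) - 2 * c)) \<le> stored_energy q h (?G x)"
      using det
    proof eventually_elim
      case (elim x)
      show ?case unfolding W_def \<kappa>_def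
        using h_C1(1) \<open>c > 0\<close>
        by (intro stored_energy_above_affine assms elim) auto
    qed
  qed
  finally show "energy \<Omega> q h u \<ge> energy \<Omega> q h (dilation c)" .
qed

end
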